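(* Let $k$ be a field, let $I$ be a monomial ideal in $R=k[x_1,\dots,x_n]$, and suppose that $J$ and $K$ are monomial ideals in $R$ such that $\mathcal{G}(I)$ is the disjoint union of $\mathcal{G}(J)$ and $\mathcal{G}(K)$. If both $J$ and $K$ have linear resolutions, then $I=J+K$ is a Betti splitting.
   Context: $\mathcal{G}(L)$ denotes the unique set of minimal monomial generators of a monomial ideal $L$. The ring $R$ is graded by the standard grading ($\deg x_i=1$) or the standard multigrading ($\deg x_i$ is the $i$-th unit vector of $\mathbb{N}^n$); "(multi)degree" refers to either, and the result holds for either. $\beta_{i,j}(L)=\dim_k\operatorname{Tor}^R_i(k,L)_j$, with $\beta_{-1,j}=0$. An ideal $L$ has a linear resolution if, for some $d$, it is generated in degree $d$ and, in the standard grading, $\beta_{i,j}(L)=0$ for all $j\ne i+d$ (the degree $d$ may differ for $J$ and $K$). Betti splitting: if $\mathcal{G}(I)$ is the disjoint union of $\mathcal{G}(J)$ and $\mathcal{G}(K)$, then $I=J+K$ is a Betti splitting if $\beta_{i,j}(I)=\beta_{i,j}(J)+\beta_{i,j}(K)+\beta_{i-1,j}(J\cap K)$ for all $i\in\mathbb{N}$ and all (multi)degrees $j$. *)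

theory Defs
  imports Complex_Main "HOL-Library.Poly_Mapping"
begin

(* The ring R = k[x_1,...,x_n] is ('n, 'k) mpoly with n = CARD('n): a polynomial maps each
   exponent vector 'n \<Rightarrow>\<^sub>0 nat to its coefficient. *)

type_synonym ('n, 'k) mpoly = "('n \<Rightarrow>\<^sub>0 nat) \<Rightarrow>\<^sub>0 'k"

interpretation ring_module: module "(*) :: 'a::comm_ring_1 \<Rightarrow> 'a \<Rightarrow> 'a"
  by unfold_locales (simp_all add: algebra_simps)

abbreviation ideal_generated :: "'a::comm_ring_1 set \<Rightarrow> 'a set" where
  "ideal_generated S \<equiv> ring_module.span S"

definition monomials :: "('n, 'k::field) mpoly set" where
  "monomials = {Poly_Mapping.single m 1 | m. True}"

definition monomial_ideal :: "('n, 'k::field) mpoly set \<Rightarrow> bool" where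
  "monomial_ideal L \<longleftrightarrow> (\<exists>S \<subseteq> monomials. L = ideal_generated S)"

definition min_gens :: "('n, 'k::field) mpoly set \<Rightarrow> ('n, 'k) mpoly set" where
  "min_gens L = (THE S. S \<subseteq> monomials \<and> ideal_generated S = L \<and>
                        (\<forall>T. T \<subset> S \<longrightarrow> ideal_generated T \<noteq> L))"


(* A grading of R is given by the degrees of its monomials. *)

definition standard_deg :: "('n::finite \<Rightarrow>\<^sub>0 nat) \<Rightarrow> nat" where
  "standard_deg m = (\<Sum>x\<in>UNIV. Poly_Mapping.lookup m x)"

definition multi_deg :: "('n \<Rightarrow>\<^sub>0 nat) \<Rightarrow> ('n \<Rightarrow>\<^sub>0 nat)" where
  "multi_deg m = m"

definition homogeneous :: "(('n \<Rightarrow>\<^sub>0 nat) \<Rightarrow> 'd) \<Rightarrow> 'd \<Rightarrow> ('n, 'k::field) mpoly \<Rightarrow> bool" where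
  "homogeneous dg e f \<longleftrightarrow> (\<forall>m \<in> Poly_Mapping.keys f. dg m = e)"


(* Vectors of free R-modules whose basis is a set of natural numbers. *)

type_synonym ('n, 'k) fvec = "nat \<Rightarrow>\<^sub>0 ('n, 'k) mpoly"

definition fscale :: "('n, 'k::field) mpoly \<Rightarrow> ('n, 'k) fvec \<Rightarrow> ('n, 'k) fvec" where
  "fscale r v = Poly_Mapping.map (\<lambda>f. r * f) v"

definition kscale :: "'k::field \<Rightarrow> ('n, 'k) fvec \<Rightarrow> ('n, 'k) fvec" where
  "kscale c v = fscale (Poly_Mapping.single 0 c) v"

interpretation fvec: vector_space "kscale :: 'k::field \<Rightarrow> ('n, 'k) fvec \<Rightarrow> ('n, 'k) fvec"
proof -
  have lookup_kscale: "Poly_Mapping.lookup (kscale c v) b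
      = Poly_Mapping.single 0 c * Poly_Mapping.lookup v b"
    for c :: 'k and v :: "('n, 'k) fvec" and b
    by (simp add: kscale_def fscale_def map.rep_eq when_def)
  show "vector_space (kscale :: 'k \<Rightarrow> ('n, 'k) fvec \<Rightarrow> ('n, 'k) fvec)"
  proof
    show "kscale a (x + y) = kscale a x + kscale a y" for a :: 'k and x y :: "('n, 'k) fvec"
      by (rule poly_mapping_eqI) (simp add: lookup_kscale lookup_add distrib_left)
    show "kscale (a + b) x = kscale a x + kscale b x" for a b :: 'k and x :: "('n, 'k) fvec"
      by (rule poly_mapping_eqI) (simp add: lookup_kscale lookup_add single_add distrib_right)
    show "kscale a (kscale b x) = kscale (a * b) x" for a b :: 'k and x :: "('n, 'k) fvec"
      by (rule poly_mapping_eqI) (simp add: lookup_kscale mult_single mult.assoc[symmetric])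
    show "kscale 1 x = x" for x :: "('n, 'k) fvec"
      by (rule poly_mapping_eqI) (simp add: lookup_kscale)
  qed
qed

(* Data of an augmented complex  ... -> P_1 -> P_0 -> k -> 0  of graded free R-modules:
   P_i has the basis (basis P i), and its basis element b has degree (shift P i b);
   (bd P i b) is the image in P_i of the basis element b of P_(i+1);
   (aug P b) is the image in k of the basis element b of P_0. *)

record (overloaded) ('n, 'k, 'd) free_complex =
  basis :: "nat \<Rightarrow> nat set"
  shift :: "nat \<Rightarrow> nat \<Rightarrow> 'd"
  bd :: "nat \<Rightarrow> nat \<Rightarrow> nat \<Rightarrow>\<^sub>0 (('n \<Rightarrow>\<^sub>0 nat) \<Rightarrow>\<^sub>0 'k)"
  aug :: "nat \<Rightarrow> 'k"

(* P_i \<otimes>\<^sub>R L for an ideal L: as P_i is free, this is the direct sum of copies of L over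
   the basis of P_i. In particular P_i itself is the case L = R = UNIV. *)

definition tensor :: "('n, 'k::field, 'd) free_complex \<Rightarrow> ('n, 'k) mpoly set \<Rightarrow> nat
    \<Rightarrow> ('n, 'k) fvec set" where
  "tensor P L i = {v. Poly_Mapping.keys v \<subseteq> basis P i \<and> (\<forall>b. Poly_Mapping.lookup v b \<in> L)}"

(* The differential P_(i+1) \<otimes> L -> P_i \<otimes> L. *)

definition diff :: "('n, 'k::field, 'd) free_complex \<Rightarrow> nat \<Rightarrow> ('n, 'k) fvec \<Rightarrow> ('n, 'k) fvec" where
  "diff P i v = (\<Sum>b \<in> Poly_Mapping.keys v. fscale (Poly_Mapping.lookup v b) (bd P i b))"

(* The augmentation P_0 -> k; a polynomial acts on k = R/(x_1,...,x_n) by its constant term. *)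

definition augmentation :: "('n, 'k::field, 'd) free_complex \<Rightarrow> ('n, 'k) fvec \<Rightarrow> 'k" where
  "augmentation P v =
     (\<Sum>b \<in> Poly_Mapping.keys v. Poly_Mapping.lookup (Poly_Mapping.lookup v b) 0 * aug P b)"

definition graded_free_resolution ::
    "(('n \<Rightarrow>\<^sub>0 nat) \<Rightarrow> 'd::comm_monoid_add) \<Rightarrow> ('n, 'k::field, 'd) free_complex \<Rightarrow> bool" where
  "graded_free_resolution dg P \<longleftrightarrow>
     (\<forall>i. finite (basis P i)) \<and>
     (\<forall>i. \<forall>b \<in> basis P (Suc i). bd P i b \<in> tensor P UNIV i \<and>
        (\<forall>a \<in> basis P i. \<forall>m \<in> Poly_Mapping.keys (Poly_Mapping.lookup (bd P i b) a).
           dg m + shift P i a = shift P (Suc i) b)) \<and>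
     (\<forall>b \<in> basis P 0. aug P b \<noteq> 0 \<longrightarrow> shift P 0 b = 0) \<and>
     augmentation P ` tensor P UNIV 0 = UNIV \<and>
     {v \<in> tensor P UNIV 0. augmentation P v = 0} = diff P 0 ` tensor P UNIV 1 \<and>
     (\<forall>i. {v \<in> tensor P UNIV (Suc i). diff P i v = 0} = diff P (Suc i) ` tensor P UNIV (Suc (Suc i)))"

(* The component of P_i \<otimes> L of degree j. *)

definition strand :: "(('n \<Rightarrow>\<^sub>0 nat) \<Rightarrow> 'd::comm_monoid_add) \<Rightarrow> ('n, 'k::field, 'd) free_complex
    \<Rightarrow> ('n, 'k) mpoly set \<Rightarrow> nat \<Rightarrow> 'd \<Rightarrow> ('n, 'k) fvec set" where
  "strand dg P L i j = {v \<in> tensor P L i. \<forall>b \<in> basis P i.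
     \<forall>m \<in> Poly_Mapping.keys (Poly_Mapping.lookup v b). dg m + shift P i b = j}"

definition cycles :: "(('n \<Rightarrow>\<^sub>0 nat) \<Rightarrow> 'd::comm_monoid_add) \<Rightarrow> ('n, 'k::field, 'd) free_complex
    \<Rightarrow> ('n, 'k) mpoly set \<Rightarrow> nat \<Rightarrow> 'd \<Rightarrow> ('n, 'k) fvec set" where
  "cycles dg P L i j =
     (case i of 0 \<Rightarrow> strand dg P L 0 j | Suc i' \<Rightarrow> {v \<in> strand dg P L i j. diff P i' v = 0})"

definition boundaries :: "(('n \<Rightarrow>\<^sub>0 nat) \<Rightarrow> 'd::comm_monoid_add) \<Rightarrow> ('n, 'k::field, 'd) free_complex
    \<Rightarrow> ('n, 'k) mpoly set \<Rightarrow> nat \<Rightarrow> 'd \<Rightarrow> ('n, 'k) fvec set" where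
  "boundaries dg P L i j = diff P i ` strand dg P L (Suc i) j"

(* Tor_i(k, L) is the homology of P \<otimes> L at i, for a graded free resolution P of k; up to
   graded isomorphism it does not depend on P. For standard_deg and multi_deg the strands
   are finite-dimensional, so dim (cycles/boundaries) is the difference of the dimensions.
   The labels of the basis elements in P are irrelevant, and k has resolutions by finitely
   generated free modules because R is Noetherian. *)

definition betti :: "(('n \<Rightarrow>\<^sub>0 nat) \<Rightarrow> 'd::comm_monoid_add) \<Rightarrow> nat \<Rightarrow> 'd
    \<Rightarrow> ('n, 'k::field) mpoly set \<Rightarrow> nat" where
  "betti dg i j L =
     (let P = (SOME P :: ('n, 'k, 'd) free_complex. graded_free_resolution dg P)
      in fvec.dim (cycles dg P L i j) - fvec.dim (boundaries dg P L i j))"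

definition linear_resolution :: "('n::finite, 'k::field) mpoly set \<Rightarrow> bool" where
  "linear_resolution L \<longleftrightarrow>
     (\<exists>d. (\<exists>S. (\<forall>f \<in> S. homogeneous standard_deg d f) \<and> L = ideal_generated S) \<and>
          (\<forall>i j. j \<noteq> i + d \<longrightarrow> betti standard_deg i j L = 0))"

definition betti_splitting :: "(('n \<Rightarrow>\<^sub>0 nat) \<Rightarrow> 'd::comm_monoid_add) \<Rightarrow> ('n, 'k::field) mpoly set
    \<Rightarrow> ('n, 'k) mpoly set \<Rightarrow> ('n, 'k) mpoly set \<Rightarrow> bool" where
  "betti_splitting dg I J K \<longleftrightarrow>
     I = {f + g | f g. f \<in> J \<and> g \<in> K} \<and>
     (\<forall>i j. betti dg i j I = betti dg i j J + betti dg i j K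
              + (case i of 0 \<Rightarrow> 0 | Suc i' \<Rightarrow> betti dg i' j (J \<inter> K)))"

end

(*
  If J is generated in degree d and K in degree e, then no monomial of J \<inter> K has degree at most
  max d e: a monomial of degree \<le> e in J \<inter> K is a minimal generator of K, hence of I, so it
  coincides with the minimal generator of J that divides it, against disjointness. Computed with
  the Koszul complex, Tor_i(k, J \<inter> K) therefore vanishes in degrees \<le> i + max d e, whereas
  Tor_i(k, J) and Tor_i(k, K) live in the degrees i + d and i + e. Hence all maps
  Tor(k, J \<inter> K) -> Tor(k, J) \<oplus> Tor(k, K) are zero, the long exact sequence of
  0 -> J \<inter> K -> J \<oplus> K -> I -> 0 splits into short ones, and a dimension count concludes.
  As Betti numbers are defined by an arbitrary resolution of k, vanishing has to be transferred
  between resolutions: this is the comparison theorem for graded free resolutions. A multigraded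
  resolution becomes a standard graded one by forgetting, and vanishing returns to the multidegrees
  on taking homogeneous components.
*)

theory Submission
  imports Defs
begin

text \<open>Betti numbers are differences of dimensions of subspaces, so no quotient, Tor module or
  connecting map is constructed. All spaces sit inside one free module: the degree-a part of P_i
  \<otimes> I is the sum of the parts for J and K, and these intersect in the part for J \<inter> K.
  That the maps on homology vanish then means that every cycle over J \<inter> K is a boundary over
  J and also a boundary over K. As the converse always holds, the boundaries over J and those over K
  intersect exactly in the cycles over J \<inter> K. This equality replaces the long exact sequence
  by inclusion-exclusion for the dimensions of kernels and images.

  Only vanishing is carried from one resolution to another, never a dimension, since the final count
  takes place in a single resolution. The Koszul complex is the reference because its basis in
  homological degree i lies in standard degree exactly i, so that a lower bound on the degrees of an
  ideal kills whole graded pieces of the complex.\<close>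

(* As a rewrite rule this is a * (b * x) = (a * b) * x, which loops with mult.assoc. *)
declare ring_module.scale_scale [simp del]

section \<open>Dimensions of subspaces\<close>

lemma image_sum_eq:
  assumes f: "\<And>x y. f (x + y) = f x + f y"
  shows "f ` {x + y |x y. x \<in> A \<and> y \<in> B} = {x + y |x y. x \<in> f ` A \<and> y \<in> f ` B}"
  by (force simp: f)

context vector_space
begin

lemma linear_subspace_kernel:
  assumes "Vector_Spaces.linear scale scale f" "subspace V"
  shows "subspace {v \<in> V. f v = 0}"
proof -
  interpret f: Vector_Spaces.linear scale scale f by fact
  show ?thesis
    using assms(2) by (auto simp: subspace_def f.add f.scale)
qed

lemma linear_subspace_image:
  assumes "Vector_Spaces.linear scale scale f" "subspace V"
  shows "subspace (f ` V)"
proof -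
  interpret f: Vector_Spaces.linear scale scale f by fact
  show ?thesis using assms(2) by (rule f.subspace_image)
qed

lemma finite_independent_subset:
  assumes "independent B" "B \<subseteq> span T" "finite T"
  shows "finite B"
  using independent_span_bound[OF assms(3) assms(1,2)] by simp

text \<open>The intended ambient space is infinite-dimensional, so finiteness enters through a
  finite \<open>T\<close> whose span contains \<open>V\<close>; the cardinality of an infinite basis
  would be 0. The images of the vectors added to a basis of the kernel form a basis of the
  image.\<close>

lemma dim_kernel_image:
  assumes f: "Vector_Spaces.linear scale scale f" and V: "subspace V" "V \<subseteq> span T" "finite T"
  shows "dim V = dim {v \<in> V. f v = 0} + dim (f ` V)"
proof -
  interpret f: Vector_Spaces.linear scale scale f by fact
  let ?N = "{v \<in> V. f v = 0}"
  have N: "subspace ?N" by (rule linear_subspace_kernel[OF f V(1)])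
  obtain A where A: "A \<subseteq> ?N" "independent A" "?N \<subseteq> span A"
    by (rule maximal_independent_subset)
  have "A \<subseteq> V" using A by auto
  then obtain B where B: "A \<subseteq> B" "B \<subseteq> V" "independent B" "V \<subseteq> span B"
    using maximal_independent_subset_extend[OF _ A(2)] by metis
  have finB: "finite B"
    using finite_independent_subset[OF B(3) _ V(3)] B(2) V(2) by blast
  have spB: "span B = V" using B V(1) by (simp add: span_subspace)
  have spA: "span A = ?N" using A N by (simp add: span_subspace)
  \<comment> \<open>The coordinates of such a vector with respect to \<open>B\<close> are supported
    both in \<open>A\<close> and in \<open>B - A\<close>.\<close>
  have inter: "span A \<inter> span (B - A) = {0}"
  proof -
    have "x = 0" if x: "x \<in> span A" "x \<in> span (B - A)" for x
    proof -
      have "representation B x b = 0" for b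
        using representation_extend[OF B(3) x(1) B(1)] representation_extend[OF B(3) x(2)]
          representation_ne_zero[of A x b] representation_ne_zero[of "B - A" x b] by auto
      moreover have "x \<in> span B" using x(1) B(1) span_mono by blast
      ultimately show ?thesis using sum_nonzero_representation_eq[OF B(3), of x] by simp
    qed
    then show ?thesis by (auto simp: span_zero)
  qed
  have sum: "\<exists>a\<in>span A. \<exists>c\<in>span (B - A). v = a + c" if "v \<in> V" for v
  proof -
    have "v \<in> span (A \<union> (B - A))" using that spB B(1) by (simp add: Un_absorb1)
    then show ?thesis unfolding span_Un by auto
  qed
  have sub: "span (B - A) \<subseteq> V" using spB span_mono[of "B - A" B] by auto
  have inj: "inj_on f (span (B - A))"
    unfolding f.inj_on_iff_eq_0[OF subspace_span]
    using inter spA sub by auto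
  have "f ` V = f ` span (B - A)"
  proof
    show "f ` V \<subseteq> f ` span (B - A)"
      using sum spA by (fastforce simp: f.add)
  qed (use sub in auto)
  then have im: "f ` V = span (f ` (B - A))" by (simp add: f.span_image)
  have "independent (f ` (B - A))"
    using f.independent_injective_image[OF _ inj] B(3) independent_mono by blast
  then have "dim (f ` V) = card (f ` (B - A))"
    unfolding im by (rule dim_span_eq_card_independent)
  also have "\<dots> = card (B - A)"
    by (rule card_image) (use inj inj_on_subset span_superset in blast)
  finally have "dim (f ` V) = card (B - A)" .
  moreover have "dim V = card B" using dim_span_eq_card_independent[OF B(3)] spB by simp
  moreover have "dim ?N = card A" using dim_span_eq_card_independent[OF A(2)] spA by simp
  ultimately show ?thesis
    using card_Diff_subset[OF finite_subset[OF B(1) finB] B(1)] card_mono[OF finB B(1)] by simp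
qed

text \<open>A substitute for the quotient map by \<open>W\<close> that stays inside the space:
  extend a basis of \<open>W\<close>, kill it and fix the added vectors.\<close>

lemma exists_linear_with_kernel:
  assumes W: "subspace W"
  shows "\<exists>p. Vector_Spaces.linear scale scale p \<and> (\<forall>x. p x = 0 \<longleftrightarrow> x \<in> W)"
proof -
  interpret vector_space_pair scale scale ..
  obtain B where B: "B \<subseteq> W" "independent B" "W \<subseteq> span B"
    by (rule maximal_independent_subset)
  obtain D where D: "B \<subseteq> D" "independent D" "UNIV \<subseteq> span D"
    using maximal_independent_subset_extend[OF subset_UNIV B(2)] by metis
  have spB: "span B = W" using B W by (simp add: span_subspace)
  define p where "p = construct D (\<lambda>b. if b \<in> B then 0 else b)"
  have lin: "Vector_Spaces.linear scale scale p"
    unfolding p_def by (rule linear_construct[OF D(2)])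
  then interpret p: Vector_Spaces.linear scale scale p .
  have pb: "p b = (if b \<in> B then 0 else b)" if "b \<in> D" for b
    unfolding p_def by (rule construct_basis[OF D(2) that])
  have zero: "p x = 0" if "x \<in> W" for x
    using that spB p.eq_0_on_span[of B x] pb D(1) by (metis subset_iff)
  have ident: "p x = x" if "x \<in> span (D - B)" for x
    using linear_eq_on[OF lin linear_id that] pb by auto
  have "x \<in> W" if "p x = 0" for x
  proof -
    have "x \<in> span (B \<union> (D - B))" using D(1,3) by (auto simp: Un_absorb1)
    then obtain a c where ac: "a \<in> span B" "c \<in> span (D - B)" "x = a + c"
      unfolding span_Un by auto
    then have "c = 0" using that zero ident spB by (simp add: p.add)
    then show ?thesis using ac spB by simp
  qed
  with lin zero show ?thesis by blast
qed

text \<open>Under a map \<open>p\<close> with kernel \<open>W\<close>, the sum and \<open>U\<close>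
  have the same image, while the kernels of \<open>p\<close> on them are \<open>W\<close> and
  \<open>U \<inter> W\<close>.\<close>

lemma dim_sum_Int:
  assumes U: "subspace U" "U \<subseteq> span T" and W: "subspace W" "W \<subseteq> span T" and T: "finite T"
  shows "dim {x + y |x y. x \<in> U \<and> y \<in> W} + dim (U \<inter> W) = dim U + dim W"
proof -
  obtain p where p: "Vector_Spaces.linear scale scale p" "\<And>x. p x = 0 \<longleftrightarrow> x \<in> W"
    using exists_linear_with_kernel[OF W(1)] by blast
  interpret p: Vector_Spaces.linear scale scale p by fact
  let ?S = "{x + y |x y. x \<in> U \<and> y \<in> W}"
  have S: "subspace ?S" by (rule subspace_sums[OF U(1) W(1)])
  have ST: "?S \<subseteq> span T" using U(2) W(2) span_add by blast
  have "W \<subseteq> ?S" using subspace_0[OF U(1)] by force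
  then have W': "{v \<in> ?S. p v = 0} = W" using p(2) by auto
  have U': "{v \<in> U. p v = 0} = U \<inter> W" using p(2) by auto
  have im: "p ` ?S = p ` U"
  proof
    have "p (x + y) = p x" if "y \<in> W" for x y using p(2)[of y] that by (simp add: p.add)
    then show "p ` ?S \<subseteq> p ` U" by auto
    have "U \<subseteq> ?S" using subspace_0[OF W(1)] by force
    then show "p ` U \<subseteq> p ` ?S" by blast
  qed
  show ?thesis
    using dim_kernel_image[OF p(1) S ST T] dim_kernel_image[OF p(1) U T]
    unfolding W' U' im by linarith
qed

text \<open>Rank-nullity on \<open>U\<close>, \<open>W\<close> and their sum is combined with the
  dimension formula for the subspaces and for their images. When \<open>f\<close> is a differential,
  the vectors in both images will account for the homology of J \<inter> K one step lower.\<close>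

lemma dim_kernel_sum:
  assumes f: "Vector_Spaces.linear scale scale f"
    and U: "subspace U" "U \<subseteq> span T" and W: "subspace W" "W \<subseteq> span T" and T: "finite T"
  shows "dim {v \<in> {x + y |x y. x \<in> U \<and> y \<in> W}. f v = 0} + dim (U \<inter> W)
    = dim {v \<in> U. f v = 0} + dim {v \<in> W. f v = 0} + dim (f ` U \<inter> f ` W)"
proof -
  interpret f: Vector_Spaces.linear scale scale f by fact
  let ?S = "{x + y |x y. x \<in> U \<and> y \<in> W}"
  have S: "subspace ?S" by (rule subspace_sums[OF U(1) W(1)])
  have ST: "?S \<subseteq> span T" using U(2) W(2) span_add by blast
  have im: "f ` ?S = {x + y |x y. x \<in> f ` U \<and> y \<in> f ` W}"
    by (rule image_sum_eq) (rule f.add)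
  have sub: "f ` U \<subseteq> span (f ` T)" "f ` W \<subseteq> span (f ` T)"
    using U(2) W(2) by (auto simp: f.span_image)
  have "dim (f ` ?S) + dim (f ` U \<inter> f ` W) = dim (f ` U) + dim (f ` W)"
    unfolding im
    by (rule dim_sum_Int[OF f.subspace_image[OF U(1)] sub(1) f.subspace_image[OF W(1)] sub(2)])
      (simp add: T)
  moreover have "dim ?S + dim (U \<inter> W) = dim U + dim W"
    by (rule dim_sum_Int[OF U W T])
  ultimately show ?thesis
    using dim_kernel_image[OF f S ST T] dim_kernel_image[OF f U T] dim_kernel_image[OF f W T]
    by linarith
qed

lemma dim_less_if_psubset:
  assumes "subspace A" "A \<subset> B" "B \<subseteq> span T" "finite T"
  shows "dim A < dim B"
proof -
  obtain C where C: "C \<subseteq> A" "independent C" "A \<subseteq> span C"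
    by (rule maximal_independent_subset)
  obtain D where D: "C \<subseteq> D" "D \<subseteq> B" "independent D" "B \<subseteq> span D"
    using maximal_independent_subset_extend[of C B] C assms(2) by (metis psubsetE subset_trans)
  have "finite D" using finite_independent_subset[OF D(3) _ assms(4)] D(2) assms(3) by blast
  moreover have "C \<noteq> D" using C D assms(1,2) by (metis psubsetE span_subspace)
  ultimately have "card C < card D" using D(1) by (simp add: psubset_card_mono psubsetI)
  then show ?thesis using C D by (metis basis_card_eq_dim)
qed

end

section \<open>Vectors and linear extensions\<close>

lemma poly_mapping_sum_single:
  fixes p :: "'a \<Rightarrow>\<^sub>0 'b::comm_monoid_add"
  shows "(\<Sum>k\<in>Poly_Mapping.keys p. Poly_Mapping.single k (Poly_Mapping.lookup p k)) = p"
  by (rule poly_mapping_eqI) (auto simp: lookup_sum lookup_single when_def in_keys_iff)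

text \<open>Statements additive in \<open>v\<close> reduce to single terms c x^m e_b, which are
  homogeneous in every grading.\<close>

lemma fvec_monomial_induct [consumes 1, case_names zero add monomial]:
  fixes v :: "('n, 'k::field) fvec"
  assumes keys: "Poly_Mapping.keys v \<subseteq> B" and zero: "P 0"
    and add: "\<And>u w. P u \<Longrightarrow> P w \<Longrightarrow> P (u + w)"
    and mon: "\<And>b m c. b \<in> B \<Longrightarrow> P (Poly_Mapping.single b (Poly_Mapping.single m c))"
  shows "P v"
proof -
  have sumI: "P (sum f A)" if "finite A" "\<And>a. a \<in> A \<Longrightarrow> P (f a)" for f :: "'c \<Rightarrow> ('n, 'k) fvec" and A
    using that by (induction A rule: finite_induct) (auto intro: zero add)
  have "P (Poly_Mapping.single b p)" if b: "b \<in> B" for b and p :: "('n, 'k) mpoly"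
  proof -
    have "(\<Sum>m\<in>Poly_Mapping.keys p. Poly_Mapping.single b (Poly_Mapping.single m (Poly_Mapping.lookup p m)))
        = Poly_Mapping.single b p" (is "sum ?f _ = _")
    proof -
      have "sum ?f M = Poly_Mapping.single b
          (\<Sum>m\<in>M. Poly_Mapping.single m (Poly_Mapping.lookup p m))" if "finite M" for M
        using that by (induction M rule: finite_induct) (simp_all add: single_add)
      then show ?thesis by (simp add: poly_mapping_sum_single)
    qed
    moreover have "P (sum ?f (Poly_Mapping.keys p))"
      by (intro sumI mon b) simp
    ultimately show ?thesis by simp
  qed
  then have "P (\<Sum>b\<in>Poly_Mapping.keys v. Poly_Mapping.single b (Poly_Mapping.lookup v b))"
    using keys by (intro sumI) auto
  then show ?thesis by (simp add: poly_mapping_sum_single)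
qed

section \<open>Linear maps between free modules, and the augmentation\<close>

lemma lookup_fscale [simp]: "Poly_Mapping.lookup (fscale r v) b = r * Poly_Mapping.lookup v b"
  by (simp add: fscale_def map.rep_eq when_def)

lemma fscale_zero_left [simp]: "fscale 0 v = 0"
  by (rule poly_mapping_eqI) simp

lemma fscale_zero_right [simp]: "fscale r 0 = 0"
  by (rule poly_mapping_eqI) simp

lemma fscale_one [simp]: "fscale 1 v = v"
  by (rule poly_mapping_eqI) simp

lemma fscale_add_left: "fscale (r + s) v = fscale r v + fscale s v"
  by (rule poly_mapping_eqI) (simp add: lookup_add distrib_right)

lemma fscale_minus_right: "fscale r (u - v) = fscale r u - fscale r v"
  by (rule poly_mapping_eqI) (simp add: lookup_minus right_diff_distrib)

lemma fscale_fscale: "fscale r (fscale s v) = fscale (r * s) v"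
  by (rule poly_mapping_eqI) (simp add: mult.assoc)

lemma fscale_sum_right: "fscale r (sum f A) = (\<Sum>a\<in>A. fscale r (f a))"
  by (rule poly_mapping_eqI) (simp add: lookup_sum sum_distrib_left)

lemma fscale_single [simp]: "fscale r (Poly_Mapping.single b p) = Poly_Mapping.single b (r * p)"
  by (rule poly_mapping_eqI) (simp add: lookup_single when_def)

text \<open>Differentials, chain maps and homotopies are all stored by their values on basis
  elements. This is the R-linear map that such values determine, so linearity is proved once for all
  of them.\<close>

definition extend :: "(nat \<Rightarrow> ('n, 'k::field) fvec) \<Rightarrow> ('n, 'k) fvec \<Rightarrow> ('n, 'k) fvec" where
  "extend \<phi> v = (\<Sum>b\<in>Poly_Mapping.keys v. fscale (Poly_Mapping.lookup v b) (\<phi> b))"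

lemma diff_eq_extend: "diff P i = extend (bd P i)"
  by (rule ext) (simp add: diff_def extend_def)

lemma extend_zero [simp]: "extend \<phi> 0 = 0"
  by (simp add: extend_def)

lemma extend_add: "extend \<phi> (u + v) = extend \<phi> u + extend \<phi> v"
  unfolding extend_def
  by (rule setsum_keys_plus_distrib) (simp_all add: fscale_add_left)

lemma extend_single [simp]: "extend \<phi> (Poly_Mapping.single b p) = fscale p (\<phi> b)"
  by (simp add: extend_def)

lemma extend_uminus: "extend \<phi> (- v) = - extend \<phi> v"
  using extend_add[of \<phi> v "- v"] by (simp add: eq_neg_iff_add_eq_0 add.commute)

lemma extend_minus: "extend \<phi> (u - v) = extend \<phi> u - extend \<phi> v"
  using extend_add[of \<phi> u "- v"] by (simp add: extend_uminus)

lemma extend_sum: "extend \<phi> (sum f A) = (\<Sum>a\<in>A. extend \<phi> (f a))"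
  by (induction A rule: infinite_finite_induct) (simp_all add: extend_add)

lemma extend_fscale: "extend \<phi> (fscale r v) = fscale r (extend \<phi> v)"
proof -
  have "extend \<phi> (fscale r v) = (\<Sum>b\<in>Poly_Mapping.keys v. fscale (r * Poly_Mapping.lookup v b) (\<phi> b))"
    unfolding extend_def by (intro sum.mono_neutral_cong_left) (auto simp: in_keys_iff)
  then show ?thesis by (simp add: extend_def fscale_sum_right fscale_fscale)
qed

lemma extend_extend: "extend \<phi> (extend \<psi> v) = extend (\<lambda>b. extend \<phi> (\<psi> b)) v"
  by (simp add: extend_def[of _ v] extend_sum extend_fscale)

lemma extend_cong:
  assumes "\<And>b. b \<in> Poly_Mapping.keys v \<Longrightarrow> \<phi> b = \<psi> b"
  shows "extend \<phi> v = extend \<psi> v"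
  unfolding extend_def using assms by (intro sum.cong) auto

lemma extend_fun_minus: "extend (\<lambda>b. \<phi> b - \<psi> b) v = extend \<phi> v - extend \<psi> v"
  by (simp add: extend_def fscale_minus_right sum_subtractf)

lemma extend_single_one [simp]: "extend (\<lambda>b. Poly_Mapping.single b 1) v = v"
  by (simp add: extend_def poly_mapping_sum_single)

lemma linear_extend: "Vector_Spaces.linear kscale kscale (extend \<phi>)"
  unfolding Vector_Spaces.linear_iff using fvec.vector_space_axioms
  by (simp add: extend_add) (simp add: extend_fscale kscale_def)

lemma augmentation_zero [simp]: "augmentation P 0 = 0"
  by (simp add: augmentation_def)

lemma augmentation_add: "augmentation P (u + v) = augmentation P u + augmentation P v"
  unfolding augmentation_def
  by (rule setsum_keys_plus_distrib) (simp_all add: lookup_add distrib_right)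

lemma augmentation_minus: "augmentation P (u - v) = augmentation P u - augmentation P v"
  using augmentation_add[of P "u - v" v] by simp

lemma augmentation_single [simp]:
  "augmentation P (Poly_Mapping.single b p) = Poly_Mapping.lookup p 0 * aug P b"
  by (simp add: augmentation_def)

lemma augmentation_sum: "augmentation P (sum f A) = (\<Sum>a\<in>A. augmentation P (f a))"
  by (induction A rule: infinite_finite_induct) (simp_all add: augmentation_add)

lemma poly_mapping_nat_add_eq_0_iff:
  fixes a b :: "'n \<Rightarrow>\<^sub>0 nat"
  shows "a + b = 0 \<longleftrightarrow> a = 0 \<and> b = 0"
  by (auto simp: poly_mapping_eq_iff lookup_add fun_eq_iff)

text \<open>A sum of exponent vectors is 0 only if both summands are. Multiplicativity of the
  constant term is what makes the augmentation linear over R.\<close>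

lemma lookup_mult_zero:
  fixes p q :: "('n, 'k::field) mpoly"
  shows "Poly_Mapping.lookup (p * q) 0 = Poly_Mapping.lookup p 0 * Poly_Mapping.lookup q 0"
proof -
  have "(0 = l + q) = (l = 0 \<and> q = 0)" for l q :: "'n \<Rightarrow>\<^sub>0 nat"
    using poly_mapping_nat_add_eq_0_iff[of l q] by auto
  then have "Poly_Mapping.lookup (p * q) 0 = (\<Sum>l. Poly_Mapping.lookup p l *
      (\<Sum>m. (Poly_Mapping.lookup q m when l = 0) when m = 0))"
    by (simp add: lookup_mult when_when conj_commute)
  also have "\<dots> = (\<Sum>l. Poly_Mapping.lookup p l * Poly_Mapping.lookup q 0 when l = 0)"
    by (simp add: mult_when)
  finally show ?thesis by simp
qed

lemma augmentation_fscale: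
  "augmentation P (fscale r v) = Poly_Mapping.lookup r 0 * augmentation P v"
proof -
  have "augmentation P (fscale r v) = (\<Sum>b\<in>Poly_Mapping.keys v.
      Poly_Mapping.lookup (r * Poly_Mapping.lookup v b) 0 * aug P b)"
    unfolding augmentation_def by (intro sum.mono_neutral_cong_left) (auto simp: in_keys_iff)
  also have "\<dots> = Poly_Mapping.lookup r 0 * augmentation P v"
    unfolding augmentation_def sum_distrib_left lookup_mult_zero
    by (intro sum.cong refl mult.assoc)
  finally show ?thesis .
qed

lemma augmentation_extend:
  "augmentation P (extend \<phi> v)
    = (\<Sum>b\<in>Poly_Mapping.keys v. Poly_Mapping.lookup (Poly_Mapping.lookup v b) 0 * augmentation P (\<phi> b))"
  by (simp add: extend_def augmentation_sum augmentation_fscale)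

section \<open>Strands and homogeneous components\<close>

abbreviation ideal :: "'a::comm_ring_1 set \<Rightarrow> bool" where
  "ideal L \<equiv> ring_module.subspace L"

lemma ideal_UNIV: "ideal UNIV"
  by (rule ring_module.subspace_UNIV)

lemma ideal_mult: "ideal L \<Longrightarrow> p \<in> L \<Longrightarrow> q * p \<in> L"
  by (rule ring_module.subspace_scale)

lemma tensor_iff: "v \<in> tensor P L i \<longleftrightarrow>
    (\<forall>b. b \<notin> basis P i \<longrightarrow> Poly_Mapping.lookup v b = 0) \<and> (\<forall>b. Poly_Mapping.lookup v b \<in> L)"
  by (auto simp: tensor_def in_keys_iff)

lemma tensor_zero: "ideal L \<Longrightarrow> 0 \<in> tensor P L i"
  by (simp add: tensor_def ring_module.subspace_0)

lemma tensor_add: "ideal L \<Longrightarrow> u \<in> tensor P L i \<Longrightarrow> v \<in> tensor P L i \<Longrightarrow> u + v \<in> tensor P L i"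
  using keys_add[of u v] by (auto simp: tensor_def lookup_add ring_module.subspace_add)

lemma tensor_fscale: "ideal L \<Longrightarrow> v \<in> tensor P L i \<Longrightarrow> fscale r v \<in> tensor P L i"
  by (auto simp: tensor_iff ideal_mult)

lemma tensor_minus: "ideal L \<Longrightarrow> u \<in> tensor P L i \<Longrightarrow> v \<in> tensor P L i \<Longrightarrow> u - v \<in> tensor P L i"
  using keys_diff[of u v] by (auto simp: tensor_def lookup_minus ring_module.subspace_diff)

lemma tensor_sum:
  "ideal L \<Longrightarrow> (\<And>a. a \<in> A \<Longrightarrow> f a \<in> tensor P L i) \<Longrightarrow> sum f A \<in> tensor P L i"
  by (induction A rule: infinite_finite_induct) (simp_all add: tensor_zero tensor_add)

lemma tensor_mono: "L \<subseteq> M \<Longrightarrow> tensor P L i \<subseteq> tensor P M i"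
  by (auto simp: tensor_def)

lemma tensor_fscale_UNIV:
  "ideal L \<Longrightarrow> r \<in> L \<Longrightarrow> v \<in> tensor P UNIV i \<Longrightarrow> fscale r v \<in> tensor P L i"
  using ideal_mult[of L r] by (auto simp: tensor_iff mult.commute[of r])

text \<open>The coefficients of \<open>v\<close> lie in L and the values of \<open>\<phi>\<close>
  have coefficients in R, so a map of free modules over R restricts to the tensor products with any
  ideal. Hence chain maps and homotopies are built once, over R.\<close>

lemma tensor_extend:
  assumes "ideal L" "v \<in> tensor P L i" "\<And>b. b \<in> basis P i \<Longrightarrow> \<phi> b \<in> tensor Q UNIV j"
  shows "extend \<phi> v \<in> tensor Q L j"
  unfolding extend_def using assms
  by (intro tensor_sum tensor_fscale_UNIV) (auto simp: tensor_def)

section \<open>Homogeneous components\<close>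

definition restrict_keys :: "'a set \<Rightarrow> ('a \<Rightarrow>\<^sub>0 'b::zero) \<Rightarrow> 'a \<Rightarrow>\<^sub>0 'b" where
  "restrict_keys A p = Poly_Mapping.mapp (\<lambda>m c. c when m \<in> A) p"

lemma lookup_restrict_keys: "Poly_Mapping.lookup (restrict_keys A p) m = (Poly_Mapping.lookup p m when m \<in> A)"
  by (simp add: restrict_keys_def lookup_mapp when_def in_keys_iff)

lemma restrict_keys_zero [simp]: "restrict_keys A 0 = 0"
  by (rule poly_mapping_eqI) (simp add: lookup_restrict_keys)

text \<open>The set of retained exponents depends on the basis element because the degree of x^m e_b
  includes the shift of b.\<close>

definition component :: "(nat \<Rightarrow> ('n \<Rightarrow>\<^sub>0 nat) set) \<Rightarrow> ('n, 'k::field) fvec \<Rightarrow> ('n, 'k) fvec" where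
  "component A v = Poly_Mapping.mapp (\<lambda>b. restrict_keys (A b)) v"

lemma lookup_component:
  "Poly_Mapping.lookup (component A v) b = restrict_keys (A b) (Poly_Mapping.lookup v b)"
  by (simp add: component_def lookup_mapp when_def in_keys_iff)

lemma component_add: "component A (u + v) = component A u + component A v"
  by (intro poly_mapping_eqI)
    (simp add: lookup_component lookup_restrict_keys lookup_add when_add_distrib)

lemma component_zero [simp]: "component A 0 = 0"
  by (rule poly_mapping_eqI) (simp add: lookup_component)

text \<open>The form in which monomial ideals enter the homological part: the homogeneous components
  of P_i \<otimes> L stay in P_i \<otimes> L, whatever the grading.\<close>

definition monomial_closed :: "('n, 'k::field) mpoly set \<Rightarrow> bool" where
  "monomial_closed L \<longleftrightarrow> (\<forall>p\<in>L. \<forall>A. restrict_keys A p \<in> L)"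

lemma monomial_closed_UNIV: "monomial_closed UNIV"
  by (simp add: monomial_closed_def)

locale grading =
  fixes dg :: "('n \<Rightarrow>\<^sub>0 nat) \<Rightarrow> 'd::comm_monoid_add"
  assumes dg_add: "dg (m + m') = dg m + dg m'"
    and dg_zero: "dg 0 = 0"
begin

abbreviation deg_component :: "('n, 'k::field, 'd) free_complex \<Rightarrow> nat \<Rightarrow> 'd \<Rightarrow> ('n, 'k) fvec \<Rightarrow> ('n, 'k) fvec" where
  "deg_component P i j \<equiv> component (\<lambda>b. {m. dg m + shift P i b = j})"

lemma strandI:
  assumes "v \<in> tensor P L i"
    and "\<And>b m. b \<in> basis P i \<Longrightarrow> m \<in> Poly_Mapping.keys (Poly_Mapping.lookup v b) \<Longrightarrow> dg m + shift P i b = j"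
  shows "v \<in> strand dg P L i j"
  using assms by (auto simp: strand_def)

lemma strand_tensor: "v \<in> strand dg P L i j \<Longrightarrow> v \<in> tensor P L i"
  by (simp add: strand_def)

lemma strand_keys: "v \<in> strand dg P L i j \<Longrightarrow> b \<in> basis P i \<Longrightarrow>
    m \<in> Poly_Mapping.keys (Poly_Mapping.lookup v b) \<Longrightarrow> dg m + shift P i b = j"
  by (simp add: strand_def)

lemma strand_mono: "L \<subseteq> M \<Longrightarrow> strand dg P L i j \<subseteq> strand dg P M i j"
  using tensor_mono[of L M P i] by (auto simp: strand_def)

lemma strand_zero: "ideal L \<Longrightarrow> 0 \<in> strand dg P L i j"
  by (simp add: strand_def tensor_zero)

lemma strand_add: "ideal L \<Longrightarrow> u \<in> strand dg P L i j \<Longrightarrow> v \<in> strand dg P L i j \<Longrightarrow>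
    u + v \<in> strand dg P L i j"
  using keys_add by (intro strandI tensor_add) (fastforce simp: strand_def lookup_add)+

lemma strand_minus: "ideal L \<Longrightarrow> u \<in> strand dg P L i j \<Longrightarrow> v \<in> strand dg P L i j \<Longrightarrow>
    u - v \<in> strand dg P L i j"
  using keys_diff by (intro strandI tensor_minus) (fastforce simp: strand_def lookup_minus)+

lemma strand_fscale:
  assumes L: "ideal L" and v: "v \<in> strand dg P L i j"
    and r: "\<And>m. m \<in> Poly_Mapping.keys r \<Longrightarrow> dg m + j = j'"
  shows "fscale r v \<in> strand dg P L i j'"
proof (rule strandI)
  show "fscale r v \<in> tensor P L i" using L v by (intro tensor_fscale strand_tensor)
next
  fix b m assume b: "b \<in> basis P i" "m \<in> Poly_Mapping.keys (Poly_Mapping.lookup (fscale r v) b)"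
  then have "m \<in> Poly_Mapping.keys (r * Poly_Mapping.lookup v b)" by simp
  then obtain m1 m2 where m: "m = m1 + m2" "m1 \<in> Poly_Mapping.keys r"
      "m2 \<in> Poly_Mapping.keys (Poly_Mapping.lookup v b)"
    using keys_mult[of r "Poly_Mapping.lookup v b"] by blast
  then show "dg m + shift P i b = j'"
    using r[OF m(2)] strand_keys[OF v b(1) m(3)] by (simp add: dg_add add.assoc)
qed

lemma strand_subspace: "ideal L \<Longrightarrow> fvec.subspace (strand dg P L i j)"
  by (rule fvec.subspaceI)
    (auto simp: strand_zero strand_add kscale_def dg_zero intro: strand_fscale split: if_splits)

lemma strand_sum: "ideal L \<Longrightarrow> (\<And>a. a \<in> A \<Longrightarrow> f a \<in> strand dg P L i j) \<Longrightarrow> sum f A \<in> strand dg P L i j"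
  by (induction A rule: infinite_finite_induct) (simp_all add: strand_zero strand_add)

text \<open>The graded form of \<open>tensor_extend\<close>: a map that sends each basis element to
  a vector of the same degree preserves all degrees.\<close>

lemma strand_extend:
  assumes L: "ideal L" and v: "v \<in> strand dg P L i j"
    and \<phi>: "\<And>b. b \<in> basis P i \<Longrightarrow> \<phi> b \<in> strand dg Q UNIV i' (shift P i b)"
  shows "extend \<phi> v \<in> strand dg Q L i' j"
proof -
  have "fscale (Poly_Mapping.lookup v b) (\<phi> b) \<in> strand dg Q L i' j"
    if "b \<in> Poly_Mapping.keys v" for b
  proof -
    have b: "b \<in> basis P i" and vb: "Poly_Mapping.lookup v b \<in> L"
      using that strand_tensor[OF v] by (auto simp: tensor_def)
    have "fscale (Poly_Mapping.lookup v b) (\<phi> b) \<in> strand dg Q UNIV i' j"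
      by (rule strand_fscale[OF ideal_UNIV \<phi>[OF b]]) (rule strand_keys[OF v b])
    moreover have "fscale (Poly_Mapping.lookup v b) (\<phi> b) \<in> tensor Q L i'"
      by (rule tensor_fscale_UNIV[OF L vb strand_tensor[OF \<phi>[OF b]]])
    ultimately show ?thesis by (simp add: strand_def)
  qed
  then show ?thesis unfolding extend_def by (rule strand_sum[OF L])
qed

lemma deg_component_strand:
  assumes "monomial_closed L" "v \<in> tensor P L i"
  shows "deg_component P i j v \<in> strand dg P L i j"
proof (rule strandI)
  show "deg_component P i j v \<in> tensor P L i"
    using assms by (auto simp: tensor_iff lookup_component monomial_closed_def)
qed (auto simp: in_keys_iff lookup_component lookup_restrict_keys when_def split: if_splits)

lemma deg_component_of_strand:
  assumes v: "v \<in> strand dg P L i j"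
  shows "deg_component P i j' v = (if j' = j then v else 0)"
proof (rule poly_mapping_eqI, rule poly_mapping_eqI)
  fix b m
  have "dg m + shift P i b = j" if "Poly_Mapping.lookup (Poly_Mapping.lookup v b) m \<noteq> 0"
  proof (rule strand_keys[OF v])
    show "b \<in> basis P i" using that strand_tensor[OF v] by (auto simp: tensor_iff)
  qed (use that in \<open>simp add: in_keys_iff\<close>)
  then show "Poly_Mapping.lookup (Poly_Mapping.lookup (deg_component P i j' v) b) m
      = Poly_Mapping.lookup (Poly_Mapping.lookup (if j' = j then v else 0) b) m"
    by (auto simp: lookup_component lookup_restrict_keys when_def)
qed

lemma monomial_strand:
  assumes "b \<in> basis P i"
  shows "Poly_Mapping.single b (Poly_Mapping.single m c) \<in> strand dg P UNIV i (dg m + shift P i b)"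
  using assms by (auto simp: strand_def tensor_def lookup_single when_def split: if_splits)

text \<open>On a single term both sides are either the full image or 0, because the term and its
  image have the same degree; additivity does the rest.\<close>

lemma deg_component_extend:
  assumes v: "v \<in> tensor P UNIV i"
    and \<phi>: "\<And>b. b \<in> basis P i \<Longrightarrow> \<phi> b \<in> strand dg Q UNIV i' (shift P i b)"
  shows "deg_component Q i' j (extend \<phi> v) = extend \<phi> (deg_component P i j v)"
proof -
  have "Poly_Mapping.keys v \<subseteq> basis P i" using v by (simp add: tensor_def)
  then show ?thesis
  proof (induction v rule: fvec_monomial_induct)
    case (monomial b m c)
    note e = monomial_strand[OF monomial, of m c]
    show ?case
      using deg_component_of_strand[OF e] deg_component_of_strand[OF strand_extend[OF ideal_UNIV e \<phi>]]
      by (simp del: extend_single)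
  qed (simp_all add: component_add extend_add)
qed

text \<open>The map out of P_0 is the augmentation. Treating it like a differential makes exactness
  one condition for all n, which suits the recursions below.\<close>

definition kern :: "('n, 'k::field, 'd) free_complex \<Rightarrow> nat \<Rightarrow> ('n, 'k) fvec \<Rightarrow> bool" where
  "kern P n v \<longleftrightarrow> (case n of 0 \<Rightarrow> augmentation P v = 0 | Suc i \<Rightarrow> diff P i v = 0)"

lemma graded_free_resolution_iff:
  fixes P :: "('n, 'k::field, 'd) free_complex"
  shows "graded_free_resolution dg P \<longleftrightarrow>
    (\<forall>i. finite (basis P i)) \<and>
    (\<forall>i. \<forall>b\<in>basis P (Suc i). bd P i b \<in> strand dg P UNIV i (shift P (Suc i) b)) \<and>
    (\<forall>b\<in>basis P 0. aug P b \<noteq> 0 \<longrightarrow> shift P 0 b = 0) \<and>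
    augmentation P ` tensor P UNIV 0 = UNIV \<and>
    (\<forall>n. {v \<in> tensor P UNIV n. kern P n v} = diff P n ` tensor P UNIV (Suc n))"
proof -
  have "(\<forall>n. {v \<in> tensor P UNIV n. kern P n v} = diff P n ` tensor P UNIV (Suc n)) \<longleftrightarrow>
      {v \<in> tensor P UNIV 0. augmentation P v = 0} = diff P 0 ` tensor P UNIV 1 \<and>
      (\<forall>i. {v \<in> tensor P UNIV (Suc i). diff P i v = 0} = diff P (Suc i) ` tensor P UNIV (Suc (Suc i)))"
    (is "(\<forall>n. ?Q n) \<longleftrightarrow> ?A \<and> (\<forall>i. ?B i)")
  proof -
    have QA: "?Q 0 = ?A" and QB: "?Q (Suc i) = ?B i" for i by (simp_all add: kern_def)
    have "(\<forall>n. Q n) \<longleftrightarrow> Q 0 \<and> (\<forall>i. Q (Suc i))" for Q :: "nat \<Rightarrow> bool"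
      by (metis not0_implies_Suc)
    from this[of ?Q] show ?thesis unfolding QA QB .
  qed
  then show ?thesis
    unfolding graded_free_resolution_def strand_def mem_Collect_eq by (rule ssubst) (rule refl)
qed

end

section \<open>Comparison of resolutions\<close>

context grading
begin

context
  fixes P :: "('n, 'k::field, 'd) free_complex"
  assumes P: "graded_free_resolution dg P"
begin

lemma resolution_finite: "finite (basis P i)"
  using P by (simp add: graded_free_resolution_def)

lemma resolution_bd: "b \<in> basis P (Suc i) \<Longrightarrow> bd P i b \<in> strand dg P UNIV i (shift P (Suc i) b)"
  using P by (simp add: graded_free_resolution_iff)

lemma resolution_diff_strand:
  "ideal L \<Longrightarrow> v \<in> strand dg P L (Suc i) j \<Longrightarrow> diff P i v \<in> strand dg P L i j"
  unfolding diff_eq_extend by (rule strand_extend) (auto intro: resolution_bd)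

lemma resolution_exact_iff: "v \<in> tensor P UNIV n \<and> kern P n v \<longleftrightarrow> v \<in> diff P n ` tensor P UNIV (Suc n)"
proof -
  have "{v \<in> tensor P UNIV n. kern P n v} = diff P n ` tensor P UNIV (Suc n)"
    using P unfolding graded_free_resolution_iff by blast
  then show ?thesis by blast
qed

lemma resolution_kern_diff: "v \<in> tensor P UNIV (Suc n) \<Longrightarrow> kern P n (diff P n v)"
  using resolution_exact_iff by blast

lemma resolution_diff_diff: "v \<in> tensor P UNIV (Suc (Suc n)) \<Longrightarrow> diff P n (diff P (Suc n) v) = 0"
  using resolution_kern_diff[of v "Suc n"] by (simp add: kern_def)

lemma resolution_deg_component_diff:
  "v \<in> tensor P UNIV (Suc i) \<Longrightarrow>
    deg_component P i j (diff P i v) = diff P i (deg_component P (Suc i) j v)"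
  unfolding diff_eq_extend by (rule deg_component_extend) (auto intro: resolution_bd)

text \<open>The differential commutes with homogeneous components, so the degree-j component of any
  preimage is still a preimage. Lifts can therefore be chosen homogeneous.\<close>

lemma resolution_exact:
  assumes v: "v \<in> strand dg P UNIV n j" and "kern P n v"
  shows "\<exists>w\<in>strand dg P UNIV (Suc n) j. diff P n w = v"
proof -
  obtain w where w: "w \<in> tensor P UNIV (Suc n)" "diff P n w = v"
    using resolution_exact_iff[of v n] strand_tensor[OF v] assms(2) by auto
  have "diff P n (deg_component P (Suc n) j w) = v"
    using resolution_deg_component_diff[OF w(1), of j] w(2) deg_component_of_strand[OF v, of j]
    by simp
  then show ?thesis by (rule bexI[OF _ deg_component_strand[OF monomial_closed_UNIV w(1)]])
qed

text \<open>Basis elements with nonzero augmentation have degree 0, and so do constants; passing to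
  the component of degree 0 leaves the augmentation unchanged.\<close>

lemma resolution_augmentation:
  "\<exists>w\<in>strand dg P UNIV 0 0. augmentation P w = c"
proof -
  have "augmentation P ` tensor P UNIV 0 = UNIV"
    using P unfolding graded_free_resolution_iff by blast
  then obtain w where w: "w \<in> tensor P UNIV 0" "augmentation P w = c"
    by (metis UNIV_I imageE)
  let ?w = "deg_component P 0 0 w"
  have shift: "shift P 0 b = 0" if "b \<in> basis P 0" "aug P b \<noteq> 0" for b
    using P that unfolding graded_free_resolution_iff by blast
  have "Poly_Mapping.keys w \<subseteq> basis P 0" using w(1) by (simp add: tensor_def)
  then have "augmentation P ?w = augmentation P w"
  proof (induction w rule: fvec_monomial_induct)
    case (monomial b m c)
    then show ?case
      using deg_component_of_strand[OF monomial_strand[OF monomial, of m c], of 0] shift[OF monomial]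
      by (cases "aug P b = 0") (auto simp: lookup_single when_def dg_zero)
  qed (simp_all add: component_add augmentation_add)
  with w(2) have "augmentation P ?w = c" by simp
  then show ?thesis by (rule bexI[OF _ deg_component_strand[OF monomial_closed_UNIV w(1)]])
qed

lemma resolution_diff_bd: "b \<in> basis P (Suc (Suc n)) \<Longrightarrow> diff P n (bd P (Suc n) b) = 0"
  using resolution_diff_diff[of "Poly_Mapping.single b 1" n]
    strand_tensor[OF monomial_strand[of b P "Suc (Suc n)" 0 1]]
  by (simp add: diff_eq_extend[of _ "Suc n"])

lemma resolution_kern_bd: "b \<in> basis P (Suc n) \<Longrightarrow> kern P n (bd P n b)"
  using resolution_kern_diff[of "Poly_Mapping.single b 1" n]
    strand_tensor[OF monomial_strand[of b P "Suc n" 0 1]]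
  by (simp add: diff_eq_extend[of _ n])

end

section \<open>Comparison maps and null-homotopies\<close>

definition chain_map :: "('n, 'k::field, 'd) free_complex \<Rightarrow> ('n, 'k, 'd) free_complex \<Rightarrow>
    (nat \<Rightarrow> nat \<Rightarrow> ('n, 'k) fvec) \<Rightarrow> bool" where
  "chain_map P Q F \<longleftrightarrow>
    (\<forall>i. \<forall>b\<in>basis P i. F i b \<in> strand dg Q UNIV i (shift P i b)) \<and>
    (\<forall>b\<in>basis P 0. augmentation Q (F 0 b) = aug P b) \<and>
    (\<forall>i. \<forall>b\<in>basis P (Suc i). diff Q i (F (Suc i) b) = extend (F i) (bd P i b))"

lemma extend_cong_tensor:
  "v \<in> tensor P L i \<Longrightarrow> (\<And>b. b \<in> basis P i \<Longrightarrow> \<phi> b = \<psi> b) \<Longrightarrow> extend \<phi> v = extend \<psi> v"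
  by (rule extend_cong) (auto simp: tensor_def)

lemma chain_map_diff:
  assumes "chain_map P Q F" "v \<in> tensor P L (Suc i)"
  shows "diff Q i (extend (F (Suc i)) v) = extend (F i) (diff P i v)"
  using assms unfolding diff_eq_extend extend_extend
  by (intro extend_cong_tensor[OF assms(2)]) (auto simp: chain_map_def diff_eq_extend)

lemma chain_map_augmentation:
  assumes "chain_map P Q F" "v \<in> tensor P L 0"
  shows "augmentation Q (extend (F 0) v) = augmentation P v"
  unfolding augmentation_extend augmentation_def[of P]
  using assms by (intro sum.cong) (auto simp: chain_map_def tensor_def)

text \<open>The identity of k is lifted step by step: as P_n is free, the images of its basis
  elements may be chosen one at a time, as preimages under the differential of \<open>Q\<close> that
  exist by exactness.\<close>

lemma exists_chain_map:
  fixes P Q :: "('n, 'k::field, 'd) free_complex"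
  assumes P: "graded_free_resolution dg P" and Q: "graded_free_resolution dg Q"
  shows "\<exists>F. chain_map P Q F"
proof -
  \<comment> \<open>The second clause says that the next level finds a cycle to lift; it is the
    invariant that keeps the recursion going. \<open>link\<close> is separate because it relates two
    consecutive levels.\<close>
  define good where "good n x \<longleftrightarrow>
      (\<forall>b\<in>basis P n. x b \<in> strand dg Q UNIV n (shift P n b)) \<and>
      (\<forall>b\<in>basis P (Suc n). kern Q n (extend x (bd P n b))) \<and>
      (n = 0 \<longrightarrow> (\<forall>b\<in>basis P 0. augmentation Q (x b) = aug P b))"
    for n and x :: "nat \<Rightarrow> ('n, 'k) fvec"
  define link where "link n x y \<longleftrightarrow> (\<forall>b\<in>basis P (Suc n). diff Q n (y b) = extend x (bd P n b))"
    for n and x y :: "nat \<Rightarrow> ('n, 'k) fvec"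
  have "\<exists>F. \<forall>n. good n (F n) \<and> link n (F n) (F (Suc n))"
  proof (rule dependent_nat_choice)
    have "\<exists>w. w \<in> strand dg Q UNIV 0 (shift P 0 b) \<and> augmentation Q w = aug P b"
      if b: "b \<in> basis P 0" for b
    \<comment> \<open>A nonzero value has a lift in degree 0, which is then the degree of
      \<open>b\<close>; for the value 0 the lift 0 fits every degree.\<close>
    proof (cases "aug P b = 0")
      case True
      then show ?thesis by (metis augmentation_zero strand_zero[OF ideal_UNIV])
    next
      case False
      then have "shift P 0 b = 0" using P b by (simp add: graded_free_resolution_def)
      then show ?thesis using resolution_augmentation[OF Q] by auto
    qed
    then obtain x where x: "\<forall>b\<in>basis P 0. x b \<in> strand dg Q UNIV 0 (shift P 0 b)
        \<and> augmentation Q (x b) = aug P b"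
      using bchoice[of "basis P 0" "\<lambda>b w. w \<in> strand dg Q UNIV 0 (shift P 0 b) \<and> augmentation Q w = aug P b"]
      by blast
    have "kern Q 0 (extend x (bd P 0 b))" if b: "b \<in> basis P 1" for b
    proof -
      have "augmentation Q (extend x (bd P 0 b)) = augmentation P (bd P 0 b)"
        unfolding augmentation_extend augmentation_def[of P]
        using x strand_tensor[OF resolution_bd[OF P, of b 0]] b
        by (intro sum.cong) (auto simp: tensor_def)
      then show ?thesis using resolution_kern_bd[OF P, of b 0] b by (simp add: kern_def)
    qed
    then show "\<exists>x. good 0 x" using x by (auto simp: good_def)
  next
    fix x n assume x: "good n x"
    have "\<exists>w. w \<in> strand dg Q UNIV (Suc n) (shift P (Suc n) b) \<and> diff Q n w = extend x (bd P n b)"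
      if b: "b \<in> basis P (Suc n)" for b
    proof -
      have "extend x (bd P n b) \<in> strand dg Q UNIV n (shift P (Suc n) b)"
        using x by (intro strand_extend[OF ideal_UNIV resolution_bd[OF P b]]) (simp add: good_def)
      moreover have "kern Q n (extend x (bd P n b))" using x b by (simp add: good_def)
      ultimately show ?thesis using resolution_exact[OF Q] by blast
    qed
    then obtain y where y: "\<forall>b\<in>basis P (Suc n). y b \<in> strand dg Q UNIV (Suc n) (shift P (Suc n) b)
        \<and> diff Q n (y b) = extend x (bd P n b)"
      using bchoice[of "basis P (Suc n)"
          "\<lambda>b w. w \<in> strand dg Q UNIV (Suc n) (shift P (Suc n) b) \<and> diff Q n w = extend x (bd P n b)"]
      by blast
    have "diff Q n (extend y (bd P (Suc n) b)) = 0" if b: "b \<in> basis P (Suc (Suc n))" for b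
    proof -
      have "diff Q n (extend y (bd P (Suc n) b)) = extend (\<lambda>b. extend x (bd P n b)) (bd P (Suc n) b)"
        unfolding diff_eq_extend extend_extend using y
        by (intro extend_cong_tensor[OF strand_tensor[OF resolution_bd[OF P b]]]) (auto simp: diff_eq_extend)
      also have "\<dots> = extend x (diff P n (bd P (Suc n) b))"
        by (simp add: diff_eq_extend extend_extend)
      finally show ?thesis by (simp add: resolution_diff_bd[OF P b])
    qed
    then have "good (Suc n) y" "link n x y"
      using y by (auto simp: good_def link_def kern_def)
    then show "\<exists>y. good (Suc n) y \<and> link n x y" by blast
  qed
  then obtain F where F: "\<And>n. good n (F n)" "\<And>n. link n (F n) (F (Suc n))" by blast
  show ?thesis
    using F(1) F(1)[of 0] F(2) by (intro exI[of _ F]) (auto simp: chain_map_def good_def link_def)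
qed

text \<open>\<open>H\<close> lifts the zero map of k. Each defect \<open>H - S d\<close> is a cycle,
  because the previous homotopy identity reduces its differential to \<open>S d d\<close>, which is
  0; exactness then provides the next values of \<open>S\<close>.\<close>

lemma exists_null_homotopy:
  fixes P :: "('n, 'k::field, 'd) free_complex"
  assumes P: "graded_free_resolution dg P"
    and H: "\<And>i b. b \<in> basis P i \<Longrightarrow> H i b \<in> strand dg P UNIV i (shift P i b)"
    and H_aug: "\<And>b. b \<in> basis P 0 \<Longrightarrow> augmentation P (H 0 b) = 0"
    and H_diff: "\<And>i b. b \<in> basis P (Suc i) \<Longrightarrow> diff P i (H (Suc i) b) = extend (H i) (bd P i b)"
  shows "\<exists>S. (\<forall>i. \<forall>b\<in>basis P i. S i b \<in> strand dg P UNIV (Suc i) (shift P i b)) \<and>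
    (\<forall>b\<in>basis P 0. diff P 0 (S 0 b) = H 0 b) \<and>
    (\<forall>i. \<forall>b\<in>basis P (Suc i). diff P (Suc i) (S (Suc i) b) = H (Suc i) b - extend (S i) (bd P i b))"
proof -
  define good where "good n x \<longleftrightarrow>
      (\<forall>b\<in>basis P n. x b \<in> strand dg P UNIV (Suc n) (shift P n b)) \<and>
      (\<forall>b\<in>basis P (Suc n). diff P n (H (Suc n) b - extend x (bd P n b)) = 0) \<and>
      (n = 0 \<longrightarrow> (\<forall>b\<in>basis P 0. diff P 0 (x b) = H 0 b))"
    for n and x :: "nat \<Rightarrow> ('n, 'k) fvec"
  define link where "link n x y \<longleftrightarrow>
      (\<forall>b\<in>basis P (Suc n). diff P (Suc n) (y b) = H (Suc n) b - extend x (bd P n b))"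
    for n and x y :: "nat \<Rightarrow> ('n, 'k) fvec"
  have "\<exists>F. \<forall>n. good n (F n) \<and> link n (F n) (F (Suc n))"
  proof (rule dependent_nat_choice)
    have "\<exists>w. w \<in> strand dg P UNIV (Suc 0) (shift P 0 b) \<and> diff P 0 w = H 0 b"
      if b: "b \<in> basis P 0" for b
    proof -
      have "kern P 0 (H 0 b)" using H_aug[OF b] by (simp add: kern_def)
      then show ?thesis using resolution_exact[OF P H[OF b]] by auto
    qed
    then obtain x where x: "\<forall>b\<in>basis P 0. x b \<in> strand dg P UNIV (Suc 0) (shift P 0 b)
        \<and> diff P 0 (x b) = H 0 b"
      using bchoice[of "basis P 0" "\<lambda>b w. w \<in> strand dg P UNIV (Suc 0) (shift P 0 b) \<and> diff P 0 w = H 0 b"]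
      by blast
    have "diff P 0 (H (Suc 0) b - extend x (bd P 0 b)) = 0" if b: "b \<in> basis P (Suc 0)" for b
    proof -
      have "extend (\<lambda>b. diff P 0 (x b)) (bd P 0 b) = extend (H 0) (bd P 0 b)"
        using x by (intro extend_cong_tensor[OF strand_tensor[OF resolution_bd[OF P b]]]) auto
      then show ?thesis using H_diff[OF b] by (simp add: diff_eq_extend extend_minus extend_extend)
    qed
    then show "\<exists>x. good 0 x" using x by (auto simp: good_def)
  next
    fix x n assume x: "good n x"
    have "\<exists>w. w \<in> strand dg P UNIV (Suc (Suc n)) (shift P (Suc n) b) \<and>
        diff P (Suc n) w = H (Suc n) b - extend x (bd P n b)"
      if b: "b \<in> basis P (Suc n)" for b
    proof -
      have "extend x (bd P n b) \<in> strand dg P UNIV (Suc n) (shift P (Suc n) b)"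
        using x by (intro strand_extend[OF ideal_UNIV resolution_bd[OF P b]]) (simp add: good_def)
      then have "H (Suc n) b - extend x (bd P n b) \<in> strand dg P UNIV (Suc n) (shift P (Suc n) b)"
        using H[OF b] by (intro strand_minus[OF ideal_UNIV])
      moreover have "kern P (Suc n) (H (Suc n) b - extend x (bd P n b))"
        using x b by (simp add: good_def kern_def)
      ultimately show ?thesis using resolution_exact[OF P] by blast
    qed
    then obtain y where y: "\<forall>b\<in>basis P (Suc n). y b \<in> strand dg P UNIV (Suc (Suc n)) (shift P (Suc n) b)
        \<and> diff P (Suc n) (y b) = H (Suc n) b - extend x (bd P n b)"
      using bchoice[of "basis P (Suc n)"
          "\<lambda>b w. w \<in> strand dg P UNIV (Suc (Suc n)) (shift P (Suc n) b) \<and>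
            diff P (Suc n) w = H (Suc n) b - extend x (bd P n b)"]
      by blast
    have "diff P (Suc n) (H (Suc (Suc n)) b - extend y (bd P (Suc n) b)) = 0"
      if b: "b \<in> basis P (Suc (Suc n))" for b
    proof -
      let ?v = "bd P (Suc n) b"
      have "extend (\<lambda>b. diff P (Suc n) (y b)) ?v = extend (\<lambda>b. H (Suc n) b - extend x (bd P n b)) ?v"
        using y by (intro extend_cong_tensor[OF strand_tensor[OF resolution_bd[OF P b]]]) auto
      also have "\<dots> = extend (H (Suc n)) ?v - extend x (diff P n ?v)"
        by (simp add: diff_eq_extend extend_extend extend_fun_minus)
      also have "\<dots> = extend (H (Suc n)) ?v"
        by (simp add: resolution_diff_bd[OF P b])
      finally show ?thesis using H_diff[OF b] by (simp add: diff_eq_extend extend_minus extend_extend)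
    qed
    then have "good (Suc n) y" "link n x y"
      using y by (auto simp: good_def link_def)
    then show "\<exists>y. good (Suc n) y \<and> link n x y" by blast
  qed
  then obtain S where S: "\<And>n. good n (S n)" "\<And>n. link n (S n) (S (Suc n))" by blast
  show ?thesis
    using S(1) S(1)[of 0] S(2) by (intro exI[of _ S]) (auto simp: good_def link_def)
qed

lemma boundaries_mono: "L \<subseteq> M \<Longrightarrow> boundaries dg P L i a \<subseteq> boundaries dg P M i a"
  unfolding boundaries_def by (intro image_mono strand_mono)

lemma cycles_mono: "L \<subseteq> M \<Longrightarrow> cycles dg P L i a \<subseteq> cycles dg P M i a"
  using strand_mono[of L M P i a] by (auto simp: cycles_def split: nat.splits)

text \<open>Vanishing of Tor_i(k, L) in degree j, expressed without dimensions so that it can be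
  carried along chain maps.\<close>

definition acyclic_at :: "('n, 'k::field, 'd) free_complex \<Rightarrow> ('n, 'k) mpoly set \<Rightarrow> nat \<Rightarrow> 'd \<Rightarrow> bool" where
  "acyclic_at P L i j \<longleftrightarrow> cycles dg P L i j \<subseteq> boundaries dg P L i j"

text \<open>With comparison maps \<open>F\<close> from P to Q and \<open>G\<close> back,
  \<open>G F z\<close> is a boundary because \<open>F z\<close> is one, and \<open>z\<close> differs
  from \<open>G F z\<close> by a boundary that a homotopy supplies. All these maps preserve degrees
  and restrict to L.\<close>

theorem acyclic_at_transfer:
  fixes P Q :: "('n, 'k::field, 'd) free_complex"
  assumes P: "graded_free_resolution dg P" and Q: "graded_free_resolution dg Q"
    and L: "ideal L" and acyclic: "acyclic_at Q L i j"
  shows "acyclic_at P L i j"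
proof -
  obtain F where F: "chain_map P Q F" using exists_chain_map[OF P Q] by blast
  obtain G where G: "chain_map Q P G" using exists_chain_map[OF Q P] by blast
  \<comment> \<open>\<open>G F - id\<close> lifts the zero map of k, hence is
    null-homotopic.\<close>
  define H where "H i b = extend (G i) (F i b) - Poly_Mapping.single b 1" for i b
  have Fs: "F i b \<in> strand dg Q UNIV i (shift P i b)" if "b \<in> basis P i" for i b
    using F that by (simp add: chain_map_def)
  have Gs: "G i b \<in> strand dg P UNIV i (shift Q i b)" if "b \<in> basis Q i" for i b
    using G that by (simp add: chain_map_def)
  have Fd: "diff Q i (F (Suc i) b) = extend (F i) (bd P i b)" if "b \<in> basis P (Suc i)" for i b
    using F that by (simp add: chain_map_def)
  have Hv: "extend (H i) v = extend (G i) (extend (F i) v) - v" for i v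
    unfolding H_def[abs_def] by (simp add: extend_fun_minus extend_extend)
  have one: "Poly_Mapping.single b 1 \<in> strand dg P UNIV i (shift P i b)" if "b \<in> basis P i" for b i
    using monomial_strand[OF that, of 0 1] by (simp add: dg_zero)
  have "\<exists>S. (\<forall>i. \<forall>b\<in>basis P i. S i b \<in> strand dg P UNIV (Suc i) (shift P i b)) \<and>
    (\<forall>b\<in>basis P 0. diff P 0 (S 0 b) = H 0 b) \<and>
    (\<forall>i. \<forall>b\<in>basis P (Suc i). diff P (Suc i) (S (Suc i) b) = H (Suc i) b - extend (S i) (bd P i b))"
  proof (rule exists_null_homotopy[OF P])
    show "H i b \<in> strand dg P UNIV i (shift P i b)" if b: "b \<in> basis P i" for i b
      unfolding H_def
      by (intro strand_minus strand_extend[OF ideal_UNIV Fs[OF b] Gs] ideal_UNIV one b)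
    show "augmentation P (H 0 b) = 0" if b: "b \<in> basis P 0" for b
      using chain_map_augmentation[OF G strand_tensor[OF Fs[OF b]]] F b
      by (simp add: H_def augmentation_minus chain_map_def)
    show "diff P i (H (Suc i) b) = extend (H i) (bd P i b)" if b: "b \<in> basis P (Suc i)" for i b
      using chain_map_diff[OF G strand_tensor[OF Fs[OF b]]] Fd[OF b]
      by (simp add: H_def[of "Suc i"] Hv diff_eq_extend extend_minus)
  qed
  then obtain S where Ss: "\<And>i b. b \<in> basis P i \<Longrightarrow> S i b \<in> strand dg P UNIV (Suc i) (shift P i b)"
    and S0: "\<And>b. b \<in> basis P 0 \<Longrightarrow> diff P 0 (S 0 b) = H 0 b"
    and SS: "\<And>i b. b \<in> basis P (Suc i) \<Longrightarrow>
      diff P (Suc i) (S (Suc i) b) = H (Suc i) b - extend (S i) (bd P i b)"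
    by blast
  show ?thesis
    unfolding acyclic_at_def
  proof
    fix z assume "z \<in> cycles dg P L i j"
    then have z: "z \<in> strand dg P L i j" and dz: "\<And>n. i = Suc n \<Longrightarrow> diff P n z = 0"
      by (auto simp: cycles_def split: nat.splits)
    have Fz: "extend (F i) z \<in> strand dg Q L i j"
      by (rule strand_extend[OF L z Fs])
    have "diff Q n (extend (F i) z) = 0" if "i = Suc n" for n
      using chain_map_diff[OF F, of z L n] strand_tensor[OF z] dz that by simp
    then have "extend (F i) z \<in> cycles dg Q L i j"
      using Fz by (auto simp: cycles_def split: nat.splits)
    then obtain w where w: "w \<in> strand dg Q L (Suc i) j" "diff Q i w = extend (F i) z"
      using acyclic by (auto simp: acyclic_at_def boundaries_def)
    have GF: "extend (G i) (extend (F i) z) = diff P i (extend (G (Suc i)) w)"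
      using chain_map_diff[OF G strand_tensor[OF w(1)]] w(2) by simp
    have "diff P i (extend (S i) z) = extend (H i) z"
    proof (cases i)
      case 0
      then show ?thesis
        using extend_cong_tensor[OF strand_tensor[OF z], of "\<lambda>b. diff P i (S i b)" "H i"] S0
        by (simp add: diff_eq_extend extend_extend)
    next
      case (Suc n)
      have "diff P i (extend (S i) z) = extend (\<lambda>b. H i b - extend (S n) (bd P n b)) z"
        unfolding diff_eq_extend extend_extend
        using SS Suc by (intro extend_cong_tensor[OF strand_tensor[OF z]]) (simp add: diff_eq_extend)
      also have "\<dots> = extend (H i) z - extend (S n) (diff P n z)"
        by (simp add: extend_fun_minus diff_eq_extend extend_extend)
      \<comment> \<open>\<open>z\<close> is a cycle, so the second term of the homotopy identity
        disappears.\<close>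
      finally show ?thesis using dz[OF Suc] by simp
    qed
    then have "z = diff P i (extend (G (Suc i)) w - extend (S i) z)"
      using GF by (simp add: Hv diff_eq_extend extend_minus)
    moreover have "extend (G (Suc i)) w - extend (S i) z \<in> strand dg P L (Suc i) j"
      by (intro strand_minus[OF L] strand_extend[OF L w(1) Gs] strand_extend[OF L z Ss])
    ultimately show "z \<in> boundaries dg P L i j"
      unfolding boundaries_def by blast
  qed
qed

end

section \<open>The Koszul complex\<close>

lemma single_nonzero_nat [simp]: "Poly_Mapping.single t (Suc n) \<noteq> 0"
  by (metis keys_single keys_zero insert_not_empty nat.simps(3))

text \<open>\<open>enc\<close> labels the basis element e_T by a natural number, as the record
  demands. \<open>ord\<close> orders the variables, which fixes the signs and singles out a least
  variable.\<close>

locale koszul = grading dg for dg :: "('n::finite \<Rightarrow>\<^sub>0 nat) \<Rightarrow> 'd::comm_monoid_add" +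
  fixes enc :: "'n set \<Rightarrow> nat" and ord :: "'n \<Rightarrow> nat"
  assumes inj_enc: "inj enc" and inj_ord: "inj ord"
begin

abbreviation var :: "'n \<Rightarrow> 'n \<Rightarrow>\<^sub>0 nat" where
  "var t \<equiv> Poly_Mapping.single t (Suc 0)"

definition sign :: "'n \<Rightarrow> 'n set \<Rightarrow> 'k::field" where
  "sign t T = (- 1) ^ card {s \<in> T. ord s < ord t}"

text \<open>The term c x^m e_T, where e_T is the basis element belonging to the set T of
  variables.\<close>

definition bmono :: "('n \<Rightarrow>\<^sub>0 nat) \<Rightarrow> 'n set \<Rightarrow> 'k::field \<Rightarrow> ('n, 'k) fvec" where
  "bmono m T c = Poly_Mapping.single (enc T) (Poly_Mapping.single m c)"

definition koszul_bd :: "'n set \<Rightarrow> ('n, 'k::field) fvec" where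
  "koszul_bd T = (\<Sum>t\<in>T. bmono (var t) (T - {t}) (sign t T))"

definition koszul_complex :: "('n, 'k::field, 'd) free_complex" where
  "koszul_complex = \<lparr>basis = (\<lambda>i. enc ` {T. card T = i}),
     shift = (\<lambda>i b. dg (\<Sum>t\<in>inv enc b. var t)),
     bd = (\<lambda>i b. koszul_bd (inv enc b)), aug = (\<lambda>b. 1)\<rparr>"

definition koszul_diff :: "('n, 'k::field) fvec \<Rightarrow> ('n, 'k) fvec" where
  "koszul_diff = extend (\<lambda>b. koszul_bd (inv enc b))"

definition least :: "'n \<Rightarrow> 'n set \<Rightarrow> bool" where
  "least w U \<longleftrightarrow> w \<in> U \<and> (\<forall>u\<in>U. ord w \<le> ord u)"

(* The contracting homotopy moves the least variable of the multidegree from m into T. *)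
definition homotopy_mono :: "('n \<Rightarrow>\<^sub>0 nat) \<Rightarrow> 'n set \<Rightarrow> 'k::field \<Rightarrow> ('n, 'k) fvec" where
  "homotopy_mono m T c =
    (let w = (THE w. least w (T \<union> Poly_Mapping.keys m))
     in if m = 0 \<and> T = {} \<or> w \<in> T then 0 else bmono (m - var w) (insert w T) c)"

definition homotopy :: "('n, 'k::field) fvec \<Rightarrow> ('n, 'k) fvec" where
  "homotopy v = (\<Sum>b\<in>Poly_Mapping.keys v. \<Sum>m\<in>Poly_Mapping.keys (Poly_Mapping.lookup v b).
     homotopy_mono m (inv enc b) (Poly_Mapping.lookup (Poly_Mapping.lookup v b) m))"

lemma bmono_zero [simp]: "bmono m T 0 = 0"
  by (simp add: bmono_def)

lemma bmono_add: "bmono m T (c + d) = bmono m T c + bmono m T d"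
  by (simp add: bmono_def single_add)

lemma inv_enc [simp]: "inv enc (enc T) = T"
  using inj_enc by simp

lemma koszul_diff_add: "koszul_diff (u + v) = koszul_diff u + koszul_diff v"
  by (simp add: koszul_diff_def extend_add)

lemma koszul_diff_minus: "koszul_diff (u - v) = koszul_diff u - koszul_diff v"
  by (simp add: koszul_diff_def extend_minus)

lemma koszul_diff_zero [simp]: "koszul_diff 0 = 0"
  by (simp add: koszul_diff_def)

lemma koszul_diff_sum: "koszul_diff (sum f A) = (\<Sum>a\<in>A. koszul_diff (f a))"
  by (simp add: koszul_diff_def extend_sum)

lemma koszul_diff_bmono:
  "koszul_diff (bmono m T c) = (\<Sum>t\<in>T. bmono (m + var t) (T - {t}) (c * sign t T))"
  by (simp add: koszul_diff_def bmono_def koszul_bd_def fscale_sum_right mult_single)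

lemma homotopy_zero [simp]: "homotopy 0 = 0"
  by (simp add: homotopy_def)

lemma homotopy_add:
  fixes u v :: "('n, 'k::field) fvec"
  shows "homotopy (u + v) = homotopy u + homotopy v"
proof -
  have c0: "homotopy_mono m T 0 = 0" for m T
    by (simp add: homotopy_mono_def Let_def)
  have cadd: "homotopy_mono m T (c + d) = homotopy_mono m T c + homotopy_mono m T d" for m T and c d :: 'k
    by (simp add: homotopy_mono_def Let_def bmono_add)
  show ?thesis
    unfolding homotopy_def
    by (rule setsum_keys_plus_distrib[where f = "\<lambda>b p. \<Sum>m\<in>Poly_Mapping.keys p.
          homotopy_mono m (inv enc b) (Poly_Mapping.lookup p m)"])
      (simp, intro setsum_keys_plus_distrib, simp_all add: c0 cadd)
qed

lemma homotopy_sum: "homotopy (sum f A) = (\<Sum>a\<in>A. homotopy (f a))"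
  by (induction A rule: infinite_finite_induct) (simp_all add: homotopy_add)

lemma homotopy_of_bmono: "homotopy (bmono m T c) = homotopy_mono m T c"
proof (cases "c = 0")
  case False
  then have "Poly_Mapping.single m c \<noteq> 0" by (metis lookup_single_eq lookup_zero)
  with False show ?thesis unfolding homotopy_def bmono_def by simp
qed (simp add: homotopy_mono_def Let_def)

lemma the_least: "least w U \<Longrightarrow> (THE w. least w U) = w"
  unfolding least_def using inj_ord by (intro the_equality) (auto dest: injD order.antisym)

lemma exists_least: "U \<noteq> {} \<Longrightarrow> \<exists>w. least w U"
  using ex_is_arg_min_if_finite[of U ord] by (auto simp: is_arg_min_linorder least_def)

lemma homotopy_in: "least w (T \<union> Poly_Mapping.keys m) \<Longrightarrow> w \<in> T \<Longrightarrow> homotopy (bmono m T c) = 0"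
  by (simp add: homotopy_of_bmono homotopy_mono_def the_least)

lemma homotopy_notin:
  assumes "least w (T \<union> Poly_Mapping.keys m)" "w \<notin> T"
  shows "homotopy (bmono m T c) = bmono (m - var w) (insert w T) c"
proof -
  have "\<not> (m = 0 \<and> T = {})" using assms(1) by (auto simp: least_def)
  then show ?thesis
    unfolding homotopy_of_bmono homotopy_mono_def the_least[OF assms(1)] Let_def using assms(2) by auto
qed

lemma sign_least: "\<forall>u\<in>T. ord w \<le> ord u \<Longrightarrow> sign w T = 1"
proof -
  assume "\<forall>u\<in>T. ord w \<le> ord u"
  then have none: "{s \<in> T. ord s < ord w} = {}" by (auto simp: not_less)
  show ?thesis unfolding sign_def none by simp
qed

lemma sign_insert:
  assumes "w \<notin> T" "t \<in> T" "\<forall>u\<in>T. ord w \<le> ord u"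
  shows "sign t (insert w T) = - sign t T"
proof -
  have "ord w \<noteq> ord t" using assms(1,2) inj_ord by (metis injD)
  then have "ord w < ord t" using assms by (metis le_neq_implies_less)
  then have "{s \<in> insert w T. ord s < ord t} = insert w {s \<in> T. ord s < ord t}" by auto
  then show ?thesis using assms(1) by (simp add: sign_def)
qed

text \<open>The union of \<open>T\<close> with the support of \<open>m\<close> is the same for every
  term of the differential, so the homotopy uses the same least \<open>w\<close> throughout. If
  \<open>w \<in> T\<close>, the homotopy kills the vector, and in its differential only the summand
  that removes \<open>w\<close> survives. If \<open>w \<notin> T\<close>, inserting \<open>w\<close>
  in front of \<open>T\<close> changes the sign of all other summands, so these cancel and the
  summand that removes \<open>w\<close> returns the vector.\<close>

lemma koszul_homotopy:
  fixes c :: "'k::field"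
  assumes "m \<noteq> 0 \<or> T \<noteq> {}"
  shows "koszul_diff (homotopy (bmono m T c)) + homotopy (koszul_diff (bmono m T c)) = bmono m T c"
proof -
  have "T \<union> Poly_Mapping.keys m \<noteq> {}" using assms by auto
  then obtain w where w: "least w (T \<union> Poly_Mapping.keys m)" using exists_least by blast
  have least_T: "\<forall>u\<in>T. ord w \<le> ord u" using w by (simp add: least_def)
  have keys: "Poly_Mapping.keys (m + var t) = insert t (Poly_Mapping.keys m)" for t
    by (auto simp: in_keys_iff lookup_add lookup_single when_def split: if_splits)
  have w': "least w ((T - {t}) \<union> Poly_Mapping.keys (m + var t))" if "t \<in> T" for t
    using w that unfolding keys least_def by auto
  show ?thesis
  proof (cases "w \<in> T")
    case True
    have "homotopy (bmono (m + var t) (T - {t}) (c * sign t T)) = (if t = w then bmono m T c else 0)"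
      if t: "t \<in> T" for t
    proof (cases "t = w")
      case True
      then show ?thesis
        using homotopy_notin[OF w'[OF t], of "c * sign t T"] sign_least[OF least_T, where ?'a = 'k] t
        by (simp add: insert_absorb)
    qed (use homotopy_in[OF w'[OF t]] \<open>w \<in> T\<close> in simp)
    then have "homotopy (koszul_diff (bmono m T c)) = (\<Sum>t\<in>T. if t = w then bmono m T c else 0)"
      by (simp add: koszul_diff_bmono homotopy_sum)
    then show ?thesis using True homotopy_in[OF w True, of c] by simp
  next
    case False
    have wm: "w \<in> Poly_Mapping.keys m" using w False by (simp add: least_def)
    \<comment> \<open>Subtraction of exponents truncates at 0; it may be exchanged with addition
      because \<open>w\<close> occurs in \<open>m\<close>.\<close>
    have shift: "m - var w + var t = m + var t - var w" for t
      using wm by (intro poly_mapping_eqI) (auto simp: lookup_add lookup_minus lookup_single when_def in_keys_iff)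
    have "m - var w + var w = m"
      unfolding shift by simp
    then have "koszul_diff (homotopy (bmono m T c)) =
        bmono m T c + (\<Sum>t\<in>T. bmono (m - var w + var t) (insert w T - {t}) (c * sign t (insert w T)))"
      using False sign_least[of "insert w T" w, where ?'a = 'k] least_T
      by (simp add: homotopy_notin[OF w False] koszul_diff_bmono)
    moreover have "(\<Sum>t\<in>T. bmono (m - var w + var t) (insert w T - {t}) (c * sign t (insert w T)))
        + homotopy (koszul_diff (bmono m T c)) = 0"
    proof -
      have "bmono (m - var w + var t) (insert w T - {t}) (c * sign t (insert w T))
          + homotopy (bmono (m + var t) (T - {t}) (c * sign t T)) = 0" if t: "t \<in> T" for t
      proof -
        have "insert w T - {t} = insert w (T - {t})" using t False by auto
        then show ?thesis
          using homotopy_notin[OF w'[OF t], of "c * sign t T"] False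
          by (simp add: sign_insert[OF False t least_T] shift bmono_add[symmetric])
      qed
      then show ?thesis
        by (simp add: koszul_diff_bmono homotopy_sum sum.distrib[symmetric])
    qed
    ultimately show ?thesis by (simp add: add.assoc)
  qed
qed

(* If w is the least element of T, then e_T = h (w e_(T - w)); as h contracts the complex, d d = 0
   follows by induction on the cardinality of T without any pairing of signs. *)
lemma koszul_diff_diff: "koszul_diff (koszul_diff v) = (0 :: ('n, 'k::field) fvec)"
proof -
  have bmono: "koszul_diff (koszul_diff (bmono m T c)) = (0 :: ('n, 'k) fvec)" for m T c
  proof (induction "card T" arbitrary: m T c rule: less_induct)
    case less
    show ?case
    proof (cases "T = {}")
      case False
      then obtain w where w: "least w T" using exists_least by blast
      let ?y = "bmono (var w) (T - {w}) (1::'k)"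
      have y: "homotopy ?y = bmono 0 T 1"
        using w homotopy_notin[of w "T - {w}" "var w" "1::'k"] by (auto simp: least_def insert_absorb)
      have dy: "koszul_diff (koszul_diff ?y) = 0"
        using w by (intro less.hyps card_Diff1_less) (auto simp: least_def)
      have "koszul_diff (homotopy (koszul_diff ?y)) + homotopy (koszul_diff (koszul_diff ?y))
          = koszul_diff ?y"
        unfolding koszul_diff_bmono[of "var w"]
        by (simp only: koszul_diff_sum homotopy_sum sum.distrib[symmetric])
          (intro sum.cong refl koszul_homotopy, simp add: poly_mapping_nat_add_eq_0_iff)
      then have "koszul_diff (homotopy (koszul_diff ?y)) = koszul_diff ?y" by (simp add: dy)
      moreover have "koszul_diff (homotopy ?y) = ?y - homotopy (koszul_diff ?y)"
        using koszul_homotopy[of "var w" "T - {w}" "1::'k"] by (simp add: algebra_simps)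
      ultimately have zero: "koszul_diff (koszul_diff (bmono 0 T (1::'k))) = 0"
        by (simp add: y[symmetric] koszul_diff_minus)
      have "bmono m T c = fscale (Poly_Mapping.single m c) (bmono 0 T 1)"
        by (simp add: bmono_def mult_single)
      then show ?thesis using zero by (simp add: koszul_diff_def extend_fscale)
    qed (simp add: koszul_diff_bmono)
  qed
  have "koszul_diff (koszul_bd T) = (0 :: ('n, 'k) fvec)" for T
    using bmono[of 0 T 1] by (simp add: koszul_diff_bmono koszul_bd_def)
  then have "(\<lambda>b. koszul_diff (koszul_bd (inv enc b))) = (\<lambda>b. 0 :: ('n, 'k) fvec)" by simp
  then show ?thesis
    by (simp add: koszul_diff_def extend_extend) (simp add: extend_def)
qed

lemma koszul_complex_simps [simp]:
  "basis koszul_complex i = enc ` {T. card T = i}"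
  "bd koszul_complex i b = koszul_bd (inv enc b)"
  "shift koszul_complex i b = dg (\<Sum>t\<in>inv enc b. var t)"
  "aug koszul_complex b = 1"
  by (simp_all add: koszul_complex_def)

lemma diff_koszul: "diff koszul_complex i = koszul_diff"
  by (simp add: diff_eq_extend koszul_diff_def koszul_complex_def)

lemma bmono_strand:
  "card T = i \<Longrightarrow> bmono m T c \<in> strand dg koszul_complex UNIV i (dg (m + (\<Sum>t\<in>T. var t)))"
  using monomial_strand[of "enc T" koszul_complex i m c] by (simp add: bmono_def dg_add)

lemma koszul_bd_strand:
  assumes "card T = Suc i"
  shows "koszul_bd T \<in> strand dg koszul_complex UNIV i (dg (\<Sum>t\<in>T. var t))"
  unfolding koszul_bd_def
proof (rule strand_sum[OF ideal_UNIV])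
  fix t assume t: "t \<in> T"
  then have "(\<Sum>s\<in>T. var s) = var t + (\<Sum>s\<in>T - {t}. var s)"
    by (simp add: sum.remove)
  then show "bmono (var t) (T - {t}) (sign t T) \<in> strand dg koszul_complex UNIV i (dg (\<Sum>t\<in>T. var t))"
    using bmono_strand[of "T - {t}" i "var t" "sign t T"] t assms by simp
qed

lemma koszul_tensor_induct [consumes 1, case_names zero add bmono]:
  assumes "v \<in> tensor koszul_complex L i" "P 0" "\<And>u w. P u \<Longrightarrow> P w \<Longrightarrow> P (u + w)"
    and "\<And>T m c. card T = i \<Longrightarrow> P (bmono m T c)"
  shows "P v"
proof -
  have "Poly_Mapping.keys v \<subseteq> enc ` {T. card T = i}" using assms(1) by (simp add: tensor_def)
  then show ?thesis
    by (induction v rule: fvec_monomial_induct) (use assms in \<open>auto simp: bmono_def\<close>)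
qed

lemma homotopy_tensor:
  assumes "v \<in> tensor koszul_complex L i"
  shows "homotopy v \<in> tensor koszul_complex UNIV (Suc i)"
  using assms
proof (induction v rule: koszul_tensor_induct)
  case (bmono T m c)
  show ?case
  proof (cases "m = 0 \<and> T = {}")
    case False
    then obtain w where w: "least w (T \<union> Poly_Mapping.keys m)"
      using exists_least[of "T \<union> Poly_Mapping.keys m"] by auto
    have "bmono (m - var w) (insert w T) c \<in> tensor koszul_complex UNIV (Suc i)" if "w \<notin> T"
      using bmono that by (intro strand_tensor[OF bmono_strand]) simp
    then show ?thesis
      using homotopy_in[OF w, of c] homotopy_notin[OF w, of c]
      by (cases "w \<in> T") (simp_all add: tensor_zero[OF ideal_UNIV])
  qed (simp add: homotopy_of_bmono homotopy_mono_def tensor_zero[OF ideal_UNIV])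
qed (simp_all add: homotopy_add tensor_zero[OF ideal_UNIV] tensor_add[OF ideal_UNIV])

lemma koszul_exact_Suc:
  assumes "v \<in> tensor koszul_complex L (Suc i)"
  shows "koszul_diff (homotopy v) + homotopy (koszul_diff v) = v"
  using assms
proof (induction v rule: koszul_tensor_induct)
  case (add u w)
  then show ?case by (simp add: homotopy_add koszul_diff_add algebra_simps)
next
  case (bmono T m c)
  then show ?case by (intro koszul_homotopy) auto
qed simp

text \<open>The contraction identity fails only at constant multiples of the basis element of the
  empty set, where the homotopy is 0. Subtracting this constant part corrects it, and on the kernel
  of the augmentation that part is 0.\<close>

lemma koszul_exact_0:
  assumes "v \<in> tensor koszul_complex L 0"
  shows "koszul_diff (homotopy v) = v - bmono 0 {} (augmentation koszul_complex v)"
  using assms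
proof (induction v rule: koszul_tensor_induct)
  case (add u w)
  then show ?case by (simp add: homotopy_add koszul_diff_add augmentation_add bmono_add)
next
  case (bmono T m c)
  then have T: "T = {}" by simp
  show ?case
  proof (cases "m = 0")
    case True
    then show ?thesis
      by (simp add: T homotopy_of_bmono homotopy_mono_def) (simp add: bmono_def)
  next
    case False
    then show ?thesis
      using koszul_homotopy[of m "{}" c] by (simp add: T koszul_diff_bmono) (simp add: bmono_def lookup_single)
  qed
qed simp

lemma augmentation_koszul_diff:
  fixes v :: "('n, 'k::field) fvec"
  shows "augmentation koszul_complex (koszul_diff v) = 0"
proof -
  have "augmentation koszul_complex (koszul_bd T :: ('n, 'k) fvec) = 0" for T
    by (simp add: koszul_bd_def augmentation_sum bmono_def lookup_single when_def)
  then show ?thesis by (simp add: koszul_diff_def augmentation_extend)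
qed

theorem koszul_resolution: "graded_free_resolution dg (koszul_complex :: ('n, 'k::field, 'd) free_complex)"
  unfolding graded_free_resolution_iff
proof (intro conjI allI ballI impI)
  let ?K = "koszul_complex :: ('n, 'k, 'd) free_complex"
  show "finite (basis ?K i)" for i by simp
  show "bd ?K i b \<in> strand dg ?K UNIV i (shift ?K (Suc i) b)" if "b \<in> basis ?K (Suc i)" for i b
    using that koszul_bd_strand by auto
  show "shift ?K 0 b = 0" if "b \<in> basis ?K 0" for b
    using that by (auto simp: dg_zero)
  have "bmono 0 {} c \<in> tensor ?K UNIV 0" "augmentation ?K (bmono 0 {} c) = c" for c
    using strand_tensor[OF bmono_strand[of "{}" 0 0 c]] by (simp_all add: bmono_def)
  then show "augmentation ?K ` tensor ?K UNIV 0 = UNIV"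
    by (metis UNIV_eq_I image_eqI)
  have sub: "koszul_diff v \<in> tensor ?K UNIV n" if "v \<in> tensor ?K UNIV (Suc n)" for v n
    unfolding koszul_diff_def
    by (intro tensor_extend[OF ideal_UNIV that]) (auto intro!: strand_tensor[OF koszul_bd_strand])
  show "{v \<in> tensor ?K UNIV n. kern ?K n v} = diff ?K n ` tensor ?K UNIV (Suc n)" for n
  proof
    show "diff ?K n ` tensor ?K UNIV (Suc n) \<subseteq> {v \<in> tensor ?K UNIV n. kern ?K n v}"
      using sub by (auto simp: kern_def diff_koszul koszul_diff_diff augmentation_koszul_diff split: nat.splits)
    show "{v \<in> tensor ?K UNIV n. kern ?K n v} \<subseteq> diff ?K n ` tensor ?K UNIV (Suc n)"
    proof safe
      fix v assume v: "v \<in> tensor ?K UNIV n" "kern ?K n v"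
      \<comment> \<open>The homotopy itself supplies the preimage of a cycle.\<close>
      then have "koszul_diff (homotopy v) = v"
        using koszul_exact_0 koszul_exact_Suc
        by (cases n) (fastforce simp: kern_def diff_koszul)+
      then show "v \<in> diff ?K n ` tensor ?K UNIV (Suc n)"
        using homotopy_tensor[OF v(1)] by (metis diff_koszul imageI)
    qed
  qed
qed

end

section \<open>Monomial ideals\<close>

abbreviation X :: "('n \<Rightarrow>\<^sub>0 nat) \<Rightarrow> ('n, 'k::field) mpoly" where
  "X m \<equiv> Poly_Mapping.single m 1"

lemma standard_deg_add: "standard_deg (m + m') = standard_deg m + standard_deg m'"
  by (simp add: standard_deg_def lookup_add sum.distrib)

lemma standard_deg_eq_0_iff: "standard_deg m = 0 \<longleftrightarrow> m = 0"
  by (auto simp: standard_deg_def poly_mapping_eq_iff fun_eq_iff)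

text \<open>The polynomials all of whose terms are divisible by monomials of \<open>S\<close> form
  an ideal containing \<open>S\<close>; conversely such a polynomial is the sum of its terms.
  Membership is thus decided term by term.\<close>

lemma in_span_monomials_iff:
  fixes S :: "('n, 'k::field) mpoly set"
  assumes S: "S \<subseteq> monomials"
  shows "p \<in> ideal_generated S \<longleftrightarrow> (\<forall>m\<in>Poly_Mapping.keys p. \<exists>s u. X s \<in> S \<and> m = s + u)"
proof
  let ?T = "{p :: ('n, 'k) mpoly. \<forall>m\<in>Poly_Mapping.keys p. \<exists>s u. X s \<in> S \<and> m = s + u}"
  have "ideal ?T"
  proof (rule ring_module.subspaceI)
    fix p q assume "p \<in> ?T" "q \<in> ?T"
    then show "p + q \<in> ?T" using keys_add[of p q] by blast
  next
    fix c p assume p: "p \<in> ?T"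
    have "\<exists>s u. X s \<in> S \<and> m = s + u" if m: "m \<in> Poly_Mapping.keys (c * p)" for m
    proof -
      obtain a b where "m = a + b" "b \<in> Poly_Mapping.keys p" using keys_mult[of c p] m by blast
      then obtain s u where "X s \<in> S" "m = s + (a + u)" using p by (force simp: ac_simps)
      then show ?thesis by blast
    qed
    then show "c * p \<in> ?T" by blast
  qed simp
  moreover have "S \<subseteq> ?T"
  proof
    fix p assume "p \<in> S"
    moreover from this S obtain m where "p = X m" by (auto simp: monomials_def)
    ultimately show "p \<in> ?T" using add_0_right[of m] by (auto simp del: add_0_right)
  qed
  ultimately have "ideal_generated S \<subseteq> ?T" by (intro ring_module.span_minimal)
  then show "p \<in> ideal_generated S \<Longrightarrow> \<forall>m\<in>Poly_Mapping.keys p. \<exists>s u. X s \<in> S \<and> m = s + u"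
    by blast
next
  assume p: "\<forall>m\<in>Poly_Mapping.keys p. \<exists>s u. X s \<in> S \<and> m = s + u"
  have "Poly_Mapping.single m (Poly_Mapping.lookup p m) \<in> ideal_generated S"
    if m: "m \<in> Poly_Mapping.keys p" for m
  proof -
    obtain s u where s: "X s \<in> S" "m = s + u" using p m by blast
    have "Poly_Mapping.single u (Poly_Mapping.lookup p m) * X s \<in> ideal_generated S"
      by (rule ring_module.span_scale[OF ring_module.span_base[OF s(1)]])
    then show ?thesis by (simp add: mult_single s(2) add.commute)
  qed
  then have "(\<Sum>m\<in>Poly_Mapping.keys p. Poly_Mapping.single m (Poly_Mapping.lookup p m)) \<in> ideal_generated S"
    by (rule ring_module.span_sum)
  then show "p \<in> ideal_generated S" by (simp add: poly_mapping_sum_single)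
qed

lemma X_in_span_iff:
  "S \<subseteq> monomials \<Longrightarrow> X m \<in> ideal_generated S \<longleftrightarrow> (\<exists>s u. X s \<in> S \<and> m = s + u)"
  by (simp add: in_span_monomials_iff)

context
  fixes L :: "('n, 'k::field) mpoly set"
  assumes L: "monomial_ideal L"
begin

lemma monomial_ideal_ideal: "ideal L"
  using L by (auto simp: monomial_ideal_def ring_module.subspace_span)

lemma monomial_ideal_iff: "p \<in> L \<longleftrightarrow> (\<forall>m\<in>Poly_Mapping.keys p. X m \<in> L)"
proof -
  obtain S where S: "S \<subseteq> monomials" "L = ideal_generated S" using L by (auto simp: monomial_ideal_def)
  show ?thesis
    unfolding S(2) in_span_monomials_iff[OF S(1)] by simp
qed

lemma monomial_ideal_closed: "monomial_closed L"
  unfolding monomial_closed_def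
proof (intro ballI allI)
  fix p A assume p: "p \<in> L"
  have "Poly_Mapping.keys (restrict_keys A p) \<subseteq> Poly_Mapping.keys p"
    by (auto simp: in_keys_iff lookup_restrict_keys when_def split: if_splits)
  then show "restrict_keys A p \<in> L"
    using p monomial_ideal_iff by (meson subset_iff)
qed

end

section \<open>Minimal monomial generators\<close>

definition minimal_monomials :: "('n, 'k::field) mpoly set \<Rightarrow> ('n, 'k) mpoly set" where
  "minimal_monomials L = {X m |m. X m \<in> L \<and> (\<forall>s u. X s \<in> L \<and> m = s + u \<longrightarrow> u = 0)}"

lemma X_eq_iff: "(X m :: ('n, 'k::field) mpoly) = X m' \<longleftrightarrow> m = m'"
  by (metis keys_single singleton_inject zero_neq_one)

lemma X_minimal_iff:
  "X m \<in> minimal_monomials L \<longleftrightarrow> X m \<in> L \<and> (\<forall>s u. X s \<in> L \<and> m = s + u \<longrightarrow> u = 0)"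
  by (auto simp: minimal_monomials_def X_eq_iff)

lemma minimal_monomials_subset: "minimal_monomials L \<subseteq> monomials" "minimal_monomials L \<subseteq> L"
  by (auto simp: minimal_monomials_def monomials_def)

text \<open>Descent on the standard degree: a monomial of L that is not minimal has a proper divisor
  in L.\<close>

lemma exists_minimal_divisor:
  fixes L :: "('n::finite, 'k::field) mpoly set"
  assumes "X m \<in> L"
  shows "\<exists>s u. X s \<in> minimal_monomials L \<and> m = s + u"
  using assms
proof (induction "standard_deg m" arbitrary: m rule: less_induct)
  case less
  show ?case
  proof (cases "X m \<in> minimal_monomials L")
    case True
    then show ?thesis by (metis add_0_right)
  next
    case False
    then obtain s u where s: "X s \<in> L" "m = s + u" "u \<noteq> 0"
      using less.prems by (auto simp: X_minimal_iff)
    then have "standard_deg s < standard_deg m"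
      by (simp add: standard_deg_add zero_less_iff_neq_zero standard_deg_eq_0_iff)
    from less.hyps[OF this s(1)] s(2) show ?thesis by (metis add.assoc)
  qed
qed

lemma span_minimal_monomials:
  fixes L :: "('n::finite, 'k::field) mpoly set"
  assumes L: "monomial_ideal L"
  shows "ideal_generated (minimal_monomials L) = L"
proof
  show "ideal_generated (minimal_monomials L) \<subseteq> L"
    by (rule ring_module.span_minimal[OF minimal_monomials_subset(2) monomial_ideal_ideal[OF L]])
  show "L \<subseteq> ideal_generated (minimal_monomials L)"
    unfolding subset_iff in_span_monomials_iff[OF minimal_monomials_subset(1)]
    using monomial_ideal_iff[OF L] exists_minimal_divisor by blast
qed

lemma minimal_monomials_subset_generators:
  assumes S: "S \<subseteq> monomials" "ideal_generated S = L"
  shows "minimal_monomials L \<subseteq> S"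
proof
  fix p assume "p \<in> minimal_monomials L"
  then obtain m where m: "p = X m" "X m \<in> L" "\<forall>s u. X s \<in> L \<and> m = s + u \<longrightarrow> u = 0"
    by (auto simp: minimal_monomials_def)
  then obtain s u where s: "X s \<in> S" "m = s + u"
    using X_in_span_iff[OF S(1)] S(2) by blast
  have "X s \<in> L" using s(1) ring_module.span_base[of _ S] S(2) by blast
  then have "u = 0" using m(3) s(2) by blast
  then show "p \<in> S" using s m(1) by simp
qed

text \<open>Every generating set of monomials contains the minimal monomials, and these already
  generate. Hence they are the only irredundant choice, and the definite description is
  meaningful.\<close>

lemma min_gens_eq:
  fixes L :: "('n::finite, 'k::field) mpoly set"
  assumes L: "monomial_ideal L"
  shows "min_gens L = minimal_monomials L"
  unfolding min_gens_def
proof (rule the_equality)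
  show "minimal_monomials L \<subseteq> monomials \<and> ideal_generated (minimal_monomials L) = L \<and>
      (\<forall>T. T \<subset> minimal_monomials L \<longrightarrow> ideal_generated T \<noteq> L)"
    using minimal_monomials_subset(1) span_minimal_monomials[OF L] minimal_monomials_subset_generators
    by (metis psubset_imp_subset psubsetE subset_trans)
next
  fix S :: "('n, 'k) mpoly set"
  assume S: "S \<subseteq> monomials \<and> ideal_generated S = L \<and> (\<forall>T. T \<subset> S \<longrightarrow> ideal_generated T \<noteq> L)"
  then show "S = minimal_monomials L"
    using minimal_monomials_subset_generators[of S L] span_minimal_monomials[OF L] by blast
qed

section \<open>Lower bounds on degrees\<close>

definition min_degree :: "nat \<Rightarrow> ('n::finite, 'k::field) mpoly set \<Rightarrow> bool" where
  "min_degree d L \<longleftrightarrow> (\<forall>p\<in>L. \<forall>m\<in>Poly_Mapping.keys p. d \<le> standard_deg m)"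

lemma min_degree_span:
  fixes S :: "('n::finite, 'k::field) mpoly set"
  assumes "\<forall>f\<in>S. homogeneous standard_deg d f"
  shows "min_degree d (ideal_generated S)"
proof -
  let ?T = "{p :: ('n, 'k) mpoly. \<forall>m\<in>Poly_Mapping.keys p. d \<le> standard_deg m}"
  have "ideal ?T"
  proof (rule ring_module.subspaceI)
    fix p q assume "p \<in> ?T" "q \<in> ?T"
    then show "p + q \<in> ?T" using keys_add[of p q] by blast
  next
    fix c p assume p: "p \<in> ?T"
    then show "c * p \<in> ?T" using keys_mult[of c p] by (fastforce simp: standard_deg_add)
  qed simp
  moreover have "S \<subseteq> ?T" using assms by (auto simp: homogeneous_def)
  ultimately show ?thesis
    unfolding min_degree_def using ring_module.span_minimal[of S ?T] by blast
qed

context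
  fixes I J K :: "('n::finite, 'k::field) mpoly set"
  assumes mon: "monomial_ideal I" "monomial_ideal J" "monomial_ideal K"
    and gens: "min_gens I = min_gens J \<union> min_gens K"
begin

lemma ideal_sum_of_min_gens: "I = {f + g |f g. f \<in> J \<and> g \<in> K}"
proof -
  have "I = ideal_generated (minimal_monomials J \<union> minimal_monomials K)"
    using gens span_minimal_monomials[OF mon(1)] by (simp add: min_gens_eq mon)
  also have "\<dots> = {f + g |f g. f \<in> J \<and> g \<in> K}"
    unfolding ring_module.span_Un span_minimal_monomials[OF mon(2)] span_minimal_monomials[OF mon(3)] ..
  finally show ?thesis .
qed

lemma min_degree_Int:
  assumes disj: "min_gens J \<inter> min_gens K = {}" and K: "min_degree e K"
  shows "min_degree (Suc e) (J \<inter> K)"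
  unfolding min_degree_def
proof (intro ballI)
  fix p m assume "p \<in> J \<inter> K" "m \<in> Poly_Mapping.keys p"
  then have m: "X m \<in> J" "X m \<in> K" using monomial_ideal_iff mon by blast+
  show "Suc e \<le> standard_deg m"
  proof (rule ccontr)
    assume "\<not> Suc e \<le> standard_deg m"
    then have le: "standard_deg m \<le> e" by simp
    \<comment> \<open>Every monomial of K has degree at least \<open>e\<close>, so one of degree at
      most \<open>e\<close> admits no proper divisor in K.\<close>
    have "u = 0" if "X s \<in> K" "m = s + u" for s u
    proof -
      have "e \<le> standard_deg s" using K that(1) by (force simp: min_degree_def)
      then show ?thesis using le by (simp add: that(2) standard_deg_add standard_deg_eq_0_iff[symmetric])
    qed
    then have mK: "X m \<in> minimal_monomials K" using m(2) by (auto simp: X_minimal_iff)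
    obtain s u where s: "X s \<in> minimal_monomials J" "m = s + u"
      using exists_minimal_divisor[OF m(1)] by blast
    have "X m \<in> minimal_monomials I" "X s \<in> I"
      using mK s(1) gens minimal_monomials_subset(2)[of I] by (auto simp: min_gens_eq mon)
    then have "u = 0" using s(2) by (auto simp: X_minimal_iff)
    then show False using s mK disj by (auto simp: min_gens_eq mon)
  qed
qed

end

section \<open>Betti numbers and splittings\<close>

lemma finite_standard_deg_le: "finite {m :: 'n::finite \<Rightarrow>\<^sub>0 nat. standard_deg m \<le> N}"
proof (rule finite_imageD)
  have le: "Poly_Mapping.lookup m x \<le> standard_deg m" for m :: "'n \<Rightarrow>\<^sub>0 nat" and x
    unfolding standard_deg_def by (rule member_le_sum) auto
  have "finite {f :: 'n \<Rightarrow> nat. \<forall>x. (x \<in> UNIV \<longrightarrow> f x \<in> {..N}) \<and> (x \<notin> UNIV \<longrightarrow> f x = 0)}"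
    by (rule finite_set_of_finite_funs) auto
  moreover have "Poly_Mapping.lookup ` {m :: 'n \<Rightarrow>\<^sub>0 nat. standard_deg m \<le> N}
      \<subseteq> {f. \<forall>x. (x \<in> UNIV \<longrightarrow> f x \<in> {..N}) \<and> (x \<notin> UNIV \<longrightarrow> f x = 0)}"
    using le by (auto intro: order_trans)
  ultimately show "finite (Poly_Mapping.lookup ` {m :: 'n \<Rightarrow>\<^sub>0 nat. standard_deg m \<le> N})"
    by (rule rev_finite_subset)
  show "inj_on Poly_Mapping.lookup {m :: 'n \<Rightarrow>\<^sub>0 nat. standard_deg m \<le> N}"
    by (auto intro: inj_onI poly_mapping_eqI)
qed

interpretation standard: grading standard_deg
  by unfold_locales (simp_all add: standard_deg_add standard_deg_eq_0_iff)

lemma exists_koszul_encoding: "\<exists>(enc :: 'n::finite set \<Rightarrow> nat) (ord :: 'n \<Rightarrow> nat). inj enc \<and> inj ord"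
  using finite_imp_inj_to_nat_seg[of "UNIV :: 'n set set"] finite_imp_inj_to_nat_seg[of "UNIV :: 'n set"]
  by auto

text \<open>In the Koszul complex the terms over L in homological degree i have degree at least i +
  D, so the strand in a smaller degree is 0. Comparison carries the vanishing to
  \<open>P\<close>.\<close>

lemma acyclic_below_min_degree:
  fixes P :: "('n::finite, 'k::field, nat) free_complex"
  assumes P: "graded_free_resolution standard_deg P" and L: "ideal L" "min_degree D L" and j: "j < i + D"
  shows "standard.acyclic_at P L i j"
proof -
  obtain enc :: "'n set \<Rightarrow> nat" and ord :: "'n \<Rightarrow> nat" where "inj enc" "inj ord"
    using exists_koszul_encoding by blast
  then interpret koszul standard_deg enc ord by unfold_locales
  let ?K = "koszul_complex :: ('n, 'k, nat) free_complex"
  have shift: "shift ?K i b = i" if b: "b \<in> basis ?K i" for b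
  proof -
    obtain T where T: "b = enc T" "card T = i" using b by auto
    have "standard_deg (\<Sum>t\<in>T. var t) = card T"
    proof (induction T rule: infinite_finite_induct)
      case (insert t T)
      have "standard_deg (var t) = 1"
        by (simp add: standard_deg_def lookup_single when_def)
      then show ?case using insert by (simp add: standard_deg_add)
    qed (simp_all add: standard.dg_zero)
    then show ?thesis by (simp add: T)
  qed
  have "v = 0" if v: "v \<in> strand standard_deg ?K L i j" for v
  proof (rule poly_mapping_eqI, rule poly_mapping_eqI, rule ccontr)
    fix b m assume "Poly_Mapping.lookup (Poly_Mapping.lookup v b) m \<noteq> Poly_Mapping.lookup (Poly_Mapping.lookup 0 b) m"
    then have m: "m \<in> Poly_Mapping.keys (Poly_Mapping.lookup v b)" by (simp add: in_keys_iff)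
    then have b: "b \<in> basis ?K i"
      using standard.strand_tensor[OF v] unfolding tensor_iff by (cases "b \<in> basis ?K i") auto
    have "D \<le> standard_deg m"
      using L(2) m standard.strand_tensor[OF v] by (auto simp: min_degree_def tensor_iff)
    then show False using standard.strand_keys[OF v b m] shift[OF b] j by simp
  qed
  then have "standard.acyclic_at ?K L i j"
    unfolding standard.acyclic_at_def
    by (auto simp: cycles_def boundaries_def diff_eq_extend standard.strand_zero[OF L(1)] intro!: image_eqI[of _ _ 0] split: nat.splits)
  then show ?thesis by (rule standard.acyclic_at_transfer[OF P koszul_resolution L(1)])
qed

(* total a is the standard degree of the monomials of degree a. *)
locale standard_refinement = grading dg for dg :: "('n::finite \<Rightarrow>\<^sub>0 nat) \<Rightarrow> 'd::comm_monoid_add" +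
  fixes total :: "'d \<Rightarrow> nat"
  assumes total_add: "total (a + b) = total a + total b"
    and total_dg: "total (dg m) = standard_deg m"
begin

lemma total_zero: "total 0 = 0"
  using total_add[of 0 0] by simp

definition coarsen :: "('n, 'k::field, 'd) free_complex \<Rightarrow> ('n, 'k, nat) free_complex" where
  "coarsen P = \<lparr>basis = basis P, shift = (\<lambda>i b. total (shift P i b)), bd = bd P, aug = aug P\<rparr>"

lemma coarsen_simps [simp]:
  "basis (coarsen P) i = basis P i" "shift (coarsen P) i b = total (shift P i b)"
  "bd (coarsen P) = bd P" "aug (coarsen P) = aug P"
  by (simp_all add: coarsen_def)

lemma tensor_coarsen: "tensor (coarsen P) = tensor P"
  by (intro ext) (simp add: tensor_def)

lemma diff_coarsen: "diff (coarsen P) = diff P"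
  by (intro ext) (simp add: diff_def)

lemma augmentation_coarsen: "augmentation (coarsen P) = augmentation P"
  by (intro ext) (simp add: augmentation_def)

lemma strand_coarsen: "strand dg P L i a \<subseteq> strand standard_deg (coarsen P) L i (total a)"
  by (auto simp: strand_def tensor_coarsen total_dg[symmetric] simp flip: total_add)

lemma coarsen_resolution:
  assumes "graded_free_resolution dg P"
  shows "graded_free_resolution standard_deg (coarsen P)"
  using assms
  unfolding graded_free_resolution_def tensor_coarsen diff_coarsen augmentation_coarsen coarsen_simps
  by (auto simp: total_dg[symmetric] total_zero simp flip: total_add)

lemma acyclic_at_refine:
  assumes P: "graded_free_resolution dg P" and L: "monomial_closed L"
    and acyclic: "standard.acyclic_at (coarsen P) L i (total a)"
  shows "acyclic_at P L i a"
  unfolding acyclic_at_def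
proof
  fix z assume z: "z \<in> cycles dg P L i a"
  then have zs: "z \<in> strand dg P L i a" by (auto simp: cycles_def split: nat.splits)
  have "z \<in> cycles standard_deg (coarsen P) L i (total a)"
    using z strand_coarsen[of P L i a] by (auto simp: cycles_def diff_coarsen split: nat.splits)
  then have "z \<in> diff P i ` strand standard_deg (coarsen P) L (Suc i) (total a)"
    using acyclic by (auto simp: standard.acyclic_at_def boundaries_def diff_coarsen)
  then obtain w where w: "w \<in> tensor P L (Suc i)" "z = diff P i w"
    by (auto simp: strand_def tensor_coarsen)
  have "w \<in> tensor P UNIV (Suc i)" using w(1) tensor_mono[of L UNIV] by blast
  \<comment> \<open>\<open>z\<close> is homogeneous of degree \<open>a\<close>, so replacing
    \<open>w\<close> by its component of degree \<open>a\<close> keeps the boundary;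
    \<open>monomial_closed\<close> keeps the coefficients in L.\<close>
  then have "z = diff P i (deg_component P (Suc i) a w)"
    using resolution_deg_component_diff[OF P, of w i a] deg_component_of_strand[OF zs, of a] w(2) by simp
  then show "z \<in> boundaries dg P L i a"
    unfolding boundaries_def using deg_component_strand[OF L w(1)] by blast
qed

lemma exists_resolution: "\<exists>P :: ('n, 'k::field, 'd) free_complex. graded_free_resolution dg P"
proof -
  obtain enc :: "'n set \<Rightarrow> nat" and ord :: "'n \<Rightarrow> nat" where "inj enc" "inj ord"
    using exists_koszul_encoding by blast
  then interpret koszul dg enc ord by unfold_locales
  show ?thesis using koszul_resolution by blast
qed

lemma finite_degree: "finite {m. dg m + s = a}"
proof (rule finite_subset)
  show "{m. dg m + s = a} \<subseteq> {m. standard_deg m \<le> total a}"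
    by (auto simp: total_add total_dg)
qed (rule finite_standard_deg_le)

section \<open>Dimensions of cycles and boundaries\<close>

context
  fixes P :: "('n, 'k::field, 'd) free_complex"
  assumes P: "graded_free_resolution dg P"
begin

text \<open>The degree \<open>a\<close> bounds the standard degrees of the exponents that occur, so
  finitely many terms span the strand. The dimension counts below take their finite spanning sets
  from here.\<close>

lemma strand_finite_dim: "\<exists>T. finite T \<and> strand dg P L i a \<subseteq> fvec.span T"
proof -
  let ?T = "\<Union>b\<in>basis P i. (\<lambda>m. Poly_Mapping.single b (Poly_Mapping.single m (1::'k))) `
    {m. dg m + shift P i b = a}"
  have span: "deg_component P i a v \<in> fvec.span ?T" if "v \<in> tensor P UNIV i" for v
  proof -
    have "Poly_Mapping.keys v \<subseteq> basis P i" using that by (simp add: tensor_def)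
    then show ?thesis
    proof (induction v rule: fvec_monomial_induct)
      case (monomial b m c)
      have "Poly_Mapping.single b (Poly_Mapping.single m c) \<in> fvec.span ?T" if "dg m + shift P i b = a"
      proof -
        have "kscale c (Poly_Mapping.single b (Poly_Mapping.single m 1)) \<in> fvec.span ?T"
          using monomial that by (intro fvec.span_scale fvec.span_base) blast
        then show ?thesis by (simp add: kscale_def mult_single)
      qed
      then show ?case
        using deg_component_of_strand[OF monomial_strand[OF monomial, of m c], of a]
        by (auto simp: fvec.span_zero)
    qed (simp_all add: component_add fvec.span_zero fvec.span_add)
  qed
  have "strand dg P L i a \<subseteq> fvec.span ?T"
  proof
    fix v assume v: "v \<in> strand dg P L i a"
    then have "v \<in> tensor P UNIV i" using strand_tensor tensor_mono[of L UNIV] by blast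
    from span[OF this] show "v \<in> fvec.span ?T" using deg_component_of_strand[OF v, of a] by simp
  qed
  moreover have "finite ?T"
    using finite_degree resolution_finite[OF P] by auto
  ultimately show ?thesis by blast
qed

lemma cycles_subset_strand: "cycles dg P L i a \<subseteq> strand dg P L i a"
  by (auto simp: cycles_def split: nat.splits)

lemma boundaries_subset_cycles:
  assumes "ideal L"
  shows "boundaries dg P L i a \<subseteq> cycles dg P L i a"
proof -
  have "diff P n (diff P (Suc n) v) = 0" if "v \<in> strand dg P L (Suc (Suc n)) a" for n v
    using resolution_diff_diff[OF P] strand_tensor[OF that] tensor_mono[of L UNIV] by blast
  then show ?thesis
    using resolution_diff_strand[OF P assms]
    by (auto simp: boundaries_def cycles_def split: nat.splits)
qed

lemma boundaries_subspace: "ideal L \<Longrightarrow> fvec.subspace (boundaries dg P L i a)"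
  unfolding boundaries_def diff_eq_extend
  by (intro fvec.linear_subspace_image[OF linear_extend] strand_subspace)

text \<open>Truncated subtraction yields only that the cycles have at most the dimension of the
  boundaries. Since boundaries are cycles, finite dimension forces equality.\<close>

lemma acyclic_at_of_dim:
  assumes L: "ideal L" and "fvec.dim (cycles dg P L i a) - fvec.dim (boundaries dg P L i a) = 0"
  shows "acyclic_at P L i a"
proof (rule ccontr)
  assume "\<not> acyclic_at P L i a"
  then have "boundaries dg P L i a \<subset> cycles dg P L i a"
    using boundaries_subset_cycles[OF L] by (auto simp: acyclic_at_def)
  moreover obtain T where "finite T" "cycles dg P L i a \<subseteq> fvec.span T"
    using strand_finite_dim[of L i a] cycles_subset_strand by blast
  ultimately have "fvec.dim (boundaries dg P L i a) < fvec.dim (cycles dg P L i a)"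
    using fvec.dim_less_if_psubset[OF boundaries_subspace[OF L]] by blast
  then show False using assms(2) by simp
qed

lemma dim_strand_Suc:
  assumes L: "ideal L"
  shows "fvec.dim (strand dg P L (Suc i) a)
    = fvec.dim (cycles dg P L (Suc i) a) + fvec.dim (boundaries dg P L i a)"
proof -
  obtain T where "finite T" "strand dg P L (Suc i) a \<subseteq> fvec.span T"
    using strand_finite_dim by blast
  then show ?thesis
    using fvec.dim_kernel_image[OF linear_extend strand_subspace[OF L]]
    by (simp add: cycles_def boundaries_def diff_eq_extend)
qed

text \<open>Guarantees that the subtraction in a Betti number is not truncated, so that dimension
  identities may be subtracted from each other.\<close>

lemma dim_boundaries_le:
  assumes L: "ideal L"
  shows "fvec.dim (boundaries dg P L i a) \<le> fvec.dim (cycles dg P L i a)"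
proof (cases "boundaries dg P L i a = cycles dg P L i a")
  case False
  obtain T where "finite T" "cycles dg P L i a \<subseteq> fvec.span T"
    using strand_finite_dim[of L i a] cycles_subset_strand by blast
  then show ?thesis
    using fvec.dim_less_if_psubset[OF boundaries_subspace[OF L]] False boundaries_subset_cycles[OF L]
    by (metis less_imp_le psubsetI)
qed simp

section \<open>The count for J \<inter> K, J, K and I\<close>

context
  fixes I J K :: "('n, 'k) mpoly set"
  assumes J: "ideal J" "monomial_closed J" and K: "ideal K" "monomial_closed K"
    and I: "ideal I" "I = {f + g |f g. f \<in> J \<and> g \<in> K}"
begin

lemma summands_subset: "J \<subseteq> I" "K \<subseteq> I"
proof -
  have "f + 0 \<in> I" if "f \<in> J" for f
    unfolding I(2) using that ring_module.subspace_0[OF K(1)] by blast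
  then show "J \<subseteq> I" by auto
  have "0 + g \<in> I" if "g \<in> K" for g
    unfolding I(2) using that ring_module.subspace_0[OF J(1)] by blast
  then show "K \<subseteq> I" by auto
qed

text \<open>Splitting each coefficient as f + g may destroy homogeneity. Taking components of degree
  \<open>a\<close> afterwards restores it without leaving J and K, because both are closed under
  removing terms.\<close>

lemma strand_sum_ideal:
  "strand dg P I i a = {x + y |x y. x \<in> strand dg P J i a \<and> y \<in> strand dg P K i a}"
proof (intro equalityI subsetI)
  fix v assume v: "v \<in> strand dg P I i a"
  have "\<forall>b. \<exists>f g. f \<in> J \<and> g \<in> K \<and> Poly_Mapping.lookup v b = f + g"
  proof
    fix b
    have "Poly_Mapping.lookup v b \<in> I" using strand_tensor[OF v] by (simp add: tensor_iff)
    then show "\<exists>f g. f \<in> J \<and> g \<in> K \<and> Poly_Mapping.lookup v b = f + g" unfolding I(2) by blast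
  qed
  then obtain f g where fg: "\<And>b. f b \<in> J" "\<And>b. g b \<in> K" "\<And>b. Poly_Mapping.lookup v b = f b + g b"
    by metis
  have part: "(\<Sum>b\<in>Poly_Mapping.keys v. Poly_Mapping.single b (h b)) \<in> tensor P L i"
    if "ideal L" "\<And>b. h b \<in> L" for h and L :: "('n, 'k) mpoly set"
    using strand_tensor[OF v] that
    by (intro tensor_sum) (auto simp: tensor_def lookup_single when_def ring_module.subspace_0 split: if_splits)
  let ?x = "\<Sum>b\<in>Poly_Mapping.keys v. Poly_Mapping.single b (f b)"
  let ?y = "\<Sum>b\<in>Poly_Mapping.keys v. Poly_Mapping.single b (g b)"
  have "v = ?x + ?y"
    using poly_mapping_sum_single[of v] by (simp add: fg(3) single_add sum.distrib)
  then have "deg_component P i a v = deg_component P i a (?x + ?y)" by (rule arg_cong)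
  then have "v = deg_component P i a ?x + deg_component P i a ?y"
    using deg_component_of_strand[OF v, of a] by (simp add: component_add)
  moreover have "deg_component P i a ?x \<in> strand dg P J i a" "deg_component P i a ?y \<in> strand dg P K i a"
    by (intro deg_component_strand J K part fg)+
  ultimately show "v \<in> {x + y |x y. x \<in> strand dg P J i a \<and> y \<in> strand dg P K i a}" by blast
next
  show "v \<in> strand dg P I i a"
    if "v \<in> {x + y |x y. x \<in> strand dg P J i a \<and> y \<in> strand dg P K i a}" for v
    using that summands_subset[THEN strand_mono, of P i a] strand_add[OF I(1), of _ P i a] by blast
qed

lemma strand_Int: "strand dg P (J \<inter> K) i a = strand dg P J i a \<inter> strand dg P K i a"
  by (auto simp: strand_def tensor_def)

(* Under the hypothesis, dim_kernel_sum for the differential on P_i \<otimes> J and P_i \<otimes> K is the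
   count of dimensions in the exact sequence 0 -> Tor_i(J) \<oplus> Tor_i(K) -> Tor_i(I) -> Tor_(i-1)(J \<inter> K) -> 0. *)
lemma splitting_of_null_inclusions:
  assumes null: "\<And>i. cycles dg P (J \<inter> K) i a \<subseteq> boundaries dg P J i a \<inter> boundaries dg P K i a"
  defines "h L i \<equiv> fvec.dim (cycles dg P L i a) - fvec.dim (boundaries dg P L i a)"
  shows "h I i = h J i + h K i + (case i of 0 \<Rightarrow> 0 | Suc i' \<Rightarrow> h (J \<inter> K) i')"
proof -
  have JK: "ideal (J \<inter> K)" by (rule ring_module.subspace_inter[OF J(1) K(1)])
  \<comment> \<open>One inclusion is the assumption. The other always holds: a common boundary has
    its coefficients in J \<inter> K and is a cycle.\<close>
  have Int: "boundaries dg P J i a \<inter> boundaries dg P K i a = cycles dg P (J \<inter> K) i a" for i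
  proof (rule antisym[OF _ null])
    show "boundaries dg P J i a \<inter> boundaries dg P K i a \<subseteq> cycles dg P (J \<inter> K) i a"
      using boundaries_subset_cycles[OF J(1), of i a] boundaries_subset_cycles[OF K(1), of i a]
      by (auto simp: cycles_def strand_Int split: nat.splits)
  qed
  obtain T where T: "finite T" "strand dg P I i a \<subseteq> fvec.span T" using strand_finite_dim by blast
  have sub: "strand dg P J i a \<subseteq> strand dg P I i a" "strand dg P K i a \<subseteq> strand dg P I i a" for i
    using summands_subset by (simp_all add: strand_mono)
  have subT: "strand dg P J i a \<subseteq> fvec.span T" "strand dg P K i a \<subseteq> fvec.span T"
    using sub[of i] T(2) by auto
  have B: "fvec.dim (boundaries dg P I i a) + fvec.dim (cycles dg P (J \<inter> K) i a)
      = fvec.dim (boundaries dg P J i a) + fvec.dim (boundaries dg P K i a)"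
  proof -
    have "boundaries dg P I i a = {x + y |x y. x \<in> boundaries dg P J i a \<and> y \<in> boundaries dg P K i a}"
      unfolding boundaries_def strand_sum_ideal diff_eq_extend by (rule image_sum_eq) (rule extend_add)
    moreover have "boundaries dg P J i a \<subseteq> fvec.span T" "boundaries dg P K i a \<subseteq> fvec.span T"
      using boundaries_subset_cycles[OF J(1), of i a] boundaries_subset_cycles[OF K(1), of i a]
        cycles_subset_strand[of J i a] cycles_subset_strand[of K i a] sub[of i] T(2) by auto
    ultimately show ?thesis
      using fvec.dim_sum_Int[OF boundaries_subspace[OF J(1)] _ boundaries_subspace[OF K(1)] _ T(1), of i a i a]
      by (simp add: Int)
  qed
  note le = dim_boundaries_le[OF I(1), of i a] dim_boundaries_le[OF J(1), of i a]
    dim_boundaries_le[OF K(1), of i a]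
  show ?thesis
  proof (cases i)
    case 0
    \<comment> \<open>In homological degree 0 the cycles are the whole strand, so the dimension
      formula for a sum suffices and no lower term arises.\<close>
    have "fvec.dim (cycles dg P I i a) + fvec.dim (cycles dg P (J \<inter> K) i a)
        = fvec.dim (cycles dg P J i a) + fvec.dim (cycles dg P K i a)"
      using fvec.dim_sum_Int[OF strand_subspace[OF J(1)] subT(1) strand_subspace[OF K(1)] subT(2) T(1)]
      unfolding strand_sum_ideal[symmetric] strand_Int[symmetric]
      by (simp add: 0 cycles_def)
    then show ?thesis using B le by (simp add: h_def 0)
  next
    case (Suc n)
    \<comment> \<open>By \<open>Int\<close>, the vectors hit from both J and K are the cycles over J
      \<inter> K in homological degree \<open>n\<close>.\<close>
    have "fvec.dim (cycles dg P I i a) + fvec.dim (strand dg P (J \<inter> K) i a)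
        = fvec.dim (cycles dg P J i a) + fvec.dim (cycles dg P K i a) + fvec.dim (cycles dg P (J \<inter> K) n a)"
      using fvec.dim_kernel_sum[OF linear_extend[of "bd P n"] strand_subspace[OF J(1)] subT(1)
          strand_subspace[OF K(1)] subT(2) T(1)]
      unfolding strand_sum_ideal[symmetric] strand_Int[symmetric] diff_eq_extend[symmetric] Int[symmetric]
      by (simp add: Suc cycles_def boundaries_def)
    \<comment> \<open>Writing the strand of J \<inter> K as its cycles plus the boundaries one step
      lower, its cycles cancel against those in \<open>B\<close>, and cycles minus boundaries at
      \<open>n\<close> remain.\<close>
    then show ?thesis
      using B le dim_strand_Suc[OF JK, of n a] dim_boundaries_le[OF JK, of n a]
      by (simp add: h_def Suc)
  qed
qed

end

end

end

text \<open>The standard grading counts as a refinement of itself, so that one proof serves both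
  gradings.\<close>

interpretation standard: standard_refinement standard_deg "\<lambda>j. j"
  by unfold_locales simp_all

text \<open>The Betti numbers refer to one chosen resolution. Transfer makes the vanishing available
  in every standard graded one, in particular in a coarsened multigraded resolution.\<close>

lemma linear_resolution_acyclic:
  fixes L :: "('n::finite, 'k::field) mpoly set"
  assumes "linear_resolution L" "ideal L"
  obtains d where "min_degree d L"
    and "\<And>P i j. graded_free_resolution standard_deg P \<Longrightarrow> j \<noteq> i + d \<Longrightarrow> standard.acyclic_at P L i j"
proof -
  obtain d S where S: "\<forall>f\<in>S. homogeneous standard_deg d f" "L = ideal_generated S"
    and betti: "\<And>i j. j \<noteq> i + d \<Longrightarrow> betti standard_deg i j L = 0"
    using assms(1) unfolding linear_resolution_def by blast
  define P0 where "P0 = (SOME P :: ('n, 'k, nat) free_complex. graded_free_resolution standard_deg P)"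
  have P0: "graded_free_resolution standard_deg P0"
    unfolding P0_def by (rule someI_ex[OF standard.exists_resolution])
  have "standard.acyclic_at P L i j" if P: "graded_free_resolution standard_deg P" and "j \<noteq> i + d" for P i j
  proof (rule standard.acyclic_at_transfer[OF P P0 assms(2)])
    show "standard.acyclic_at P0 L i j"
      using betti[OF that(2)] standard.acyclic_at_of_dim[OF P0 assms(2)]
      by (simp add: betti_def P0_def[symmetric])
  qed
  then show ?thesis using that min_degree_span[OF S(1)] S(2) by blast
qed

lemma (in standard_refinement) linear_betti_splitting:
  fixes I J K :: "('n, 'k::field) mpoly set"
  assumes mon: "monomial_ideal I" "monomial_ideal J" "monomial_ideal K"
    and gens: "min_gens I = min_gens J \<union> min_gens K" and disj: "min_gens J \<inter> min_gens K = {}"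
    and lin: "linear_resolution J" "linear_resolution K"
  shows "betti_splitting dg I J K"
proof -
  note ideals = mon[THEN monomial_ideal_ideal]
  have JK: "ideal (J \<inter> K)" using ideals by (intro ring_module.subspace_inter)
  have JK_closed: "monomial_closed (J \<inter> K)"
    using mon[THEN monomial_ideal_closed] by (auto simp: monomial_closed_def)
  obtain d where d: "min_degree d J"
    "\<And>P i j. graded_free_resolution standard_deg P \<Longrightarrow> j \<noteq> i + d \<Longrightarrow> standard.acyclic_at P J i j"
    using linear_resolution_acyclic[OF lin(1) ideals(2)] by blast
  obtain e where e: "min_degree e K"
    "\<And>P i j. graded_free_resolution standard_deg P \<Longrightarrow> j \<noteq> i + e \<Longrightarrow> standard.acyclic_at P K i j"
    using linear_resolution_acyclic[OF lin(2) ideals(3)] by blast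
  have "min_degree (Suc e) (J \<inter> K)"
    by (rule min_degree_Int[OF mon gens disj e(1)])
  moreover have "min_degree (Suc d) (J \<inter> K)"
    using min_degree_Int[OF mon(1,3,2) _ _ d(1)] gens disj by (simp add: Un_commute Int_commute)
  ultimately have Int_degree: "min_degree (Suc (max d e)) (J \<inter> K)"
    by (simp add: max_def)
  define P where "P = (SOME P :: ('n, 'k, 'd) free_complex. graded_free_resolution dg P)"
  have P: "graded_free_resolution dg P"
    unfolding P_def by (rule someI_ex[OF exists_resolution])
  note coarse = coarsen_resolution[OF P]
  have null: "cycles dg P (J \<inter> K) i a \<subseteq> boundaries dg P J i a \<inter> boundaries dg P K i a" for i a
  \<comment> \<open>A map on homology is zero as soon as its source or its target is. Up to the
    bound the source over J \<inter> K vanishes; above it both targets do.\<close>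
  proof (cases "total a \<le> i + max d e")
    case True
    then have "acyclic_at P (J \<inter> K) i a"
      by (intro acyclic_at_refine[OF P JK_closed] acyclic_below_min_degree[OF coarse JK Int_degree]) simp
    then show ?thesis
      using boundaries_mono[of "J \<inter> K" J P i a] boundaries_mono[of "J \<inter> K" K P i a]
      by (auto simp: acyclic_at_def)
  next
    case False
    then have "acyclic_at P J i a" "acyclic_at P K i a"
      by (auto intro!: acyclic_at_refine[OF P] monomial_ideal_closed mon d(2)[OF coarse] e(2)[OF coarse])
    then show ?thesis
      using cycles_mono[of "J \<inter> K" J P i a] cycles_mono[of "J \<inter> K" K P i a]
      by (auto simp: acyclic_at_def)
  qed
  have sum: "I = {f + g |f g. f \<in> J \<and> g \<in> K}"
    by (rule ideal_sum_of_min_gens[OF mon gens])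
  have "betti dg i j I = betti dg i j J + betti dg i j K
      + (case i of 0 \<Rightarrow> 0 | Suc i' \<Rightarrow> betti dg i' j (J \<inter> K))" for i j
    using splitting_of_null_inclusions[OF P ideals(2) monomial_ideal_closed[OF mon(2)]
        ideals(3) monomial_ideal_closed[OF mon(3)] ideals(1) sum null, of i j]
    by (simp add: betti_def P_def[symmetric] split: nat.splits)
  with sum show ?thesis unfolding betti_splitting_def by blast
qed

interpretation multi: standard_refinement multi_deg standard_deg
  by unfold_locales (simp_all add: multi_deg_def standard_deg_add)

theorem corollary2p4:
  fixes I J K :: "('n::finite, 'k::field) mpoly set"
  assumes "monomial_ideal I" and "monomial_ideal J" and "monomial_ideal K"
    and "min_gens I = min_gens J \<union> min_gens K" and "min_gens J \<inter> min_gens K = {}"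
    and "linear_resolution J" and "linear_resolution K"
  shows "betti_splitting standard_deg I J K \<and> betti_splitting multi_deg I J K"
  using standard.linear_betti_splitting[OF assms] multi.linear_betti_splitting[OF assms] by blast

end
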